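(* Consider the deep linear ResNet setting described in the context, and assume: (i) for every $N\ge1$ and $n\in\{1,\dots,N\}$, $\sqrt{\ell^N(0)}<\frac{m}{4\sqrt{2Me^3}}$ and $\|\theta_n^N(0)\|\le\frac14$; (ii) there is $C_0>0$ with $\|\theta_{n+1}^N(0)-\theta_n^N(0)\|\le\frac{C_0}{N}$ for all $N$ and $n$; (iii) there is a function $\psi_{\mathrm{init}}:[0,1]\to\mathbb{R}^{d\times d}$ such that $\sup_{s\in[0,1]}\|\psi_N(s,0)-\psi_{\mathrm{init}}(s)\|=O(\frac1N)$ as $N\to\infty$. Then the sequence $(\psi_N)_{N\ge1}$ converges uniformly on $[0,1]\times\mathbb{R}_+$ to a limit $\psi:[0,1]\times\mathbb{R}_+\to\mathbb{R}^{d\times d}$ which is Lipschitz continuous in $(s,t)$, with $\sup_{(s,t)\in[0,1]\times\mathbb{R}_+}\|\psi(s,t)-\psi_N(s,t)\|=O(\frac1N)$. Furthermore, $\Pi^N(t)$ converges as $N\to\infty$, uniformly in $t\in\mathbb{R}_+$, to the linear map $x_0\mapsto x(1)$, where $x$ solves the Neural ODE $\frac{dx}{ds}(s)=\psi(s,t)x(s)$ on $[0,1]$ with $x(0)=x_0$.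
   Context: Let $d\ge1$, $\Sigma\in\mathbb{R}^{d\times d}$ symmetric positive definite with largest eigenvalue $M>0$ and smallest eigenvalue $m>0$, and $B\in\mathbb{R}^{d\times d}$. For $A\in\mathbb{R}^{d\times d}$ put $\|A\|_\Sigma^2=\mathrm{Tr}(A\Sigma A^\top)$. For each integer $N\ge1$ and parameters $\theta_1^N,\dots,\theta_N^N\in\mathbb{R}^{d\times d}$, let $\Pi^N=(I_d+\frac{\theta_N^N}{N})\cdots(I_d+\frac{\theta_1^N}{N})$ and $L(\theta_1^N,\dots,\theta_N^N)=\|\Pi^N-B\|_\Sigma^2$. The parameters evolve by the rescaled gradient flow $\frac{d\theta_n^N}{dt}(t)=-N\nabla_{\theta_n^N}L(\theta_1^N(t),\dots,\theta_N^N(t))$ for $t\ge0$, and $\ell^N(t)=L(\theta_1^N(t),\dots,\theta_N^N(t))$, $\Pi^N(t)$ is $\Pi^N$ evaluated at $\theta^N(t)$. For $s\in[0,1]$, $t\ge0$, $\psi_N(s,t)=\theta^N_{\lfloor Ns\rfloor}(t)$ (with the convention $\theta_0^N:=\theta_1^N$). $\|\cdot\|$ denotes the spectral (operator) norm of matrices. *)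

theory Defs
  imports "HOL-Analysis.Analysis"
begin

type_synonym 'd mat = "real^'d^'d"

definition spec_norm :: "'d::finite mat \<Rightarrow> real" where
  "spec_norm A = onorm (\<lambda>x. A *v x)"

definition eigvals :: "'d::finite mat \<Rightarrow> real set" where
  "eigvals S = {lam. \<exists>v. v \<noteq> 0 \<and> S *v v = lam *\<^sub>R v}"

definition sym_pos_def :: "'d::finite mat \<Rightarrow> bool" where
  "sym_pos_def S \<longleftrightarrow> transpose S = S \<and> (\<forall>x. x \<noteq> 0 \<longrightarrow> x \<bullet> (S *v x) > 0)"

definition sq_sigma_norm :: "'d::finite mat \<Rightarrow> 'd mat \<Rightarrow> real" where
  "sq_sigma_norm S A = trace (A ** S ** transpose A)"

fun resprod :: "nat \<Rightarrow> (nat \<Rightarrow> 'd::finite mat) \<Rightarrow> nat \<Rightarrow> 'd mat" where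
  "resprod N th 0 = mat 1"
| "resprod N th (Suc k) = (mat 1 + (1 / real N) *\<^sub>R th (Suc k)) ** resprod N th k"

definition PiN :: "nat \<Rightarrow> (nat \<Rightarrow> 'd::finite mat) \<Rightarrow> 'd mat" where
  "PiN N th = resprod N th N"

definition lossN :: "'d::finite mat \<Rightarrow> 'd mat \<Rightarrow> nat \<Rightarrow> (nat \<Rightarrow> 'd mat) \<Rightarrow> real" where
  "lossN S B N th = sq_sigma_norm S (PiN N th - B)"

text \<open>Rescaled gradient flow: for n in 1..N and t >= 0,
  d/dt theta_n(t) = - N * grad_{theta_n} L(theta(t)), where the gradient is
  taken w.r.t. the Frobenius inner product (the inner product of real^'d^'d).\<close>
definition grad_flow :: "'d::finite mat \<Rightarrow> 'd mat \<Rightarrow> nat \<Rightarrow> (nat \<Rightarrow> real \<Rightarrow> 'd mat) \<Rightarrow> bool" where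
  "grad_flow S B N th \<longleftrightarrow>
    (\<forall>t\<ge>0. \<forall>n\<in>{1..N}. \<exists>G.
        ((\<lambda>X. lossN S B N ((\<lambda>k. th k t)(n := X))) has_derivative (\<lambda>H. G \<bullet> H)) (at (th n t))
      \<and> ((\<lambda>u. th n u) has_vector_derivative (- real N *\<^sub>R G)) (at t within {0..}))"

definition psiN :: "nat \<Rightarrow> (nat \<Rightarrow> real \<Rightarrow> 'd::finite mat) \<Rightarrow> real \<Rightarrow> real \<Rightarrow> 'd mat" where
  "psiN N th s t = (let k = nat \<lfloor>real N * s\<rfloor> in if k = 0 then th 1 t else th k t)"

end

theory Submission
  imports Defs
begin

text \<open>
  While all parameters have operator norm at most \<open>1/2\<close>, the partial products of layers are
  uniformly well conditioned, so the loss satisfies a Polyak--Lojasiewicz inequality and decays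
  like \<open>exp (- 2 c t)\<close> with \<open>c = 2 m / e\<close>. The total distance travelled is then below \<open>1/4\<close>, which
  closes a bootstrap argument and makes every bound global in time; integrating the difference of
  two neighbouring equations keeps neighbouring parameters \<open>O(1/N)\<close>-close.

  Depths are compared only along multiples: layer \<open>j\<close> of the network of depth \<open>N k\<close> is compared with
  layer \<open>j div k\<close> of the network of depth \<open>N\<close>, so that both products can be matched block by block.
  The difference of the two residuals solves a linear equation whose homogeneous part contracts at
  rate \<open>c\<close> and whose source is the parameter gap times \<open>exp (- c t)\<close>. Hence the parameter gap
  obeys a Gronwall inequality with the integrable kernel \<open>(1 + t) exp (- c t)\<close> and is \<open>O(1/N)\<close>
  uniformly in time. Any two depths \<open>M\<close>, \<open>N\<close> are compared through \<open>M N\<close>.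

  The flow of the limiting ODE is obtained as the limit of the discrete partial products, which
  satisfy the equation up to a quadratic remainder.
\<close>

section \<open>Matrix norms\<close>

text \<open>The obstacle is uniformity in time: a Lipschitz estimate followed by Gronwall compares
  two depths only on bounded time intervals. Here every parameter velocity is a residual pushed back
  through the network, and residuals decay. To exploit this the residual gap must decay too, so it
  is estimated from its own equation. At fixed parameters the kernel operator \<open>ntk\<close> is
  linear, hence adding and subtracting \<open>coarse.ntk (fine.resid s)\<close> leaves the coercive
  \<open>coarse.ntk\<close> acting on the gap, plus an operator defect acting on the decaying fine
  residual.

  Two constants need care. The N - 1 layers around a given layer change Frobenius norms by a factor
  between \<open>exp (-1/2)\<close> and \<open>exp (1/2)\<close>; this gives the 1/e in the decay
  rate and, with the threshold on the initial loss, a travelled distance of at most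
  \<open>1 / (4 * sqrt 2)\<close>.

  The assumptions and the conclusion use the operator norm, whereas gradients live in the Frobenius
  inner product. Product estimates therefore mix both norms, and the dimension enters, as
  \<open>norm (mat 1)\<close>, only where an operator bound is turned into a Frobenius
  bound.\<close>

lemma spec_norm_bound: "norm (A *v x) \<le> spec_norm A * norm x"
  for A :: "'d::finite mat"
  unfolding spec_norm_def by (rule onorm[OF matrix_vector_mul_bounded_linear])

lemma spec_norm_nonneg [simp]: "0 \<le> spec_norm A"
  for A :: "'d::finite mat"
  unfolding spec_norm_def by (rule onorm_pos_le[OF matrix_vector_mul_bounded_linear])

lemma spec_norm_leI: "(\<And>x. norm (A *v x) \<le> b * norm x) \<Longrightarrow> spec_norm A \<le> b"
  for A :: "'d::finite mat"
  unfolding spec_norm_def by (rule onorm_le)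

lemma spec_norm_add_le: "spec_norm (A + B) \<le> spec_norm A + spec_norm B"
  for A B :: "'d::finite mat"
  unfolding spec_norm_def matrix_vector_mult_add_rdistrib
  by (rule onorm_triangle) simp_all

lemma spec_norm_scaleR: "spec_norm (r *\<^sub>R A) = \<bar>r\<bar> * spec_norm A"
  for A :: "'d::finite mat"
  unfolding spec_norm_def scaleR_matrix_vector_assoc[symmetric]
  by (rule onorm_scaleR) simp

lemma spec_norm_minus_commute: "spec_norm (A - B) = spec_norm (B - A)"
  for A B :: "'d::finite mat"
  using spec_norm_scaleR[of "-1" "A - B"] by simp

lemma spec_norm_diff_triangle: "spec_norm (A - C) \<le> spec_norm (A - B) + spec_norm (B - C)"
  for A B C :: "'d::finite mat"
  using spec_norm_add_le[of "A - B" "B - C"] by simp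

lemma spec_norm_zero [simp]: "spec_norm (0 :: 'd::finite mat) = 0"
  using spec_norm_scaleR[of 0 "0 :: 'd mat"] by simp

lemma spec_norm_sum_le: "spec_norm (\<Sum>i\<in>A. G i) \<le> (\<Sum>i\<in>A. spec_norm (G i))"
  for G :: "'i \<Rightarrow> 'd::finite mat"
  by (induction A rule: infinite_finite_induct)
    (auto intro: order.trans[OF spec_norm_add_le])

lemma spec_norm_mult_le: "spec_norm (A ** B) \<le> spec_norm A * spec_norm B"
  for A B :: "'d::finite mat"
proof (rule spec_norm_leI)
  fix x :: "real^'d"
  have "norm ((A ** B) *v x) \<le> spec_norm A * norm (B *v x)"
    by (simp add: matrix_vector_mul_assoc[symmetric] spec_norm_bound)
  also have "\<dots> \<le> spec_norm A * (spec_norm B * norm x)"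
    by (intro mult_left_mono spec_norm_bound) simp
  finally show "norm ((A ** B) *v x) \<le> spec_norm A * spec_norm B * norm x"
    by (simp add: mult.assoc)
qed

lemma spec_norm_one_le: "spec_norm (mat 1 :: 'd::finite mat) \<le> 1"
  by (rule spec_norm_leI) simp

text \<open>Testing \<open>A\<close> on \<open>transpose A *v x\<close> bounds the squared norm of
  that vector by \<open>spec_norm A * norm x\<close> times its norm, which cancels. Applied to the
  transpose as well, it gives equality.\<close>

lemma spec_norm_transpose_le: "spec_norm (transpose A) \<le> spec_norm A"
  for A :: "'d::finite mat"
proof (rule spec_norm_leI)
  fix x :: "real^'d"
  let ?y = "transpose A *v x"
  have "norm ?y * norm ?y = x \<bullet> (A *v ?y)"
    by (metis dot_lmul_matrix power2_eq_square power2_norm_eq_inner transpose_matrix_vector)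
  also have "\<dots> \<le> norm x * (spec_norm A * norm ?y)"
    by (rule order.trans[OF norm_cauchy_schwarz]) (simp add: mult_left_mono spec_norm_bound)
  finally have "norm ?y * norm ?y \<le> (spec_norm A * norm x) * norm ?y"
    by (simp add: mult_ac)
  then show "norm ?y \<le> spec_norm A * norm x"
    by (cases "norm ?y = 0") (auto simp: mult_le_cancel_right)
qed

lemma spec_norm_transpose [simp]: "spec_norm (transpose A) = spec_norm A"
  for A :: "'d::finite mat"
  using spec_norm_transpose_le[of A] spec_norm_transpose_le[of "transpose A"] by simp

lemma norm_power2_sum_column: "(norm X)\<^sup>2 = (\<Sum>j\<in>UNIV. (norm (column j X))\<^sup>2)"
  for X :: "'d::finite mat"
  unfolding power2_norm_eq_inner inner_vec_def column_def
  by (simp, rule sum.swap)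

lemma norm_power2_sum_row: "(norm X)\<^sup>2 = (\<Sum>i\<in>UNIV. (norm (X $ i))\<^sup>2)"
  for X :: "'d::finite mat"
  unfolding power2_norm_eq_inner by (simp add: inner_vec_def)

lemma column_matrix_mult: "column j (A ** X) = A *v column j X"
  for A X :: "'d::finite mat"
  by (simp add: column_def matrix_matrix_mult_def matrix_vector_mult_def vec_eq_iff)

lemma norm_transpose [simp]: "norm (transpose X) = norm X"
  for X :: "'d::finite mat"
proof -
  have "(norm (transpose X))\<^sup>2 = (norm X)\<^sup>2"
    unfolding norm_power2_sum_column[of X] norm_power2_sum_row[of "transpose X"]
    by (simp add: column_def transpose_def)
  then show ?thesis by simp
qed

text \<open>Multiplication acts on each column separately, so the operator norm of one factor
  suffices and no dimension factor appears.\<close>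

lemma norm_mult_le_left: "norm (A ** X) \<le> spec_norm A * norm X"
  for A X :: "'d::finite mat"
proof (rule power2_le_imp_le)
  have "(norm (A ** X))\<^sup>2 \<le> (\<Sum>j\<in>UNIV. (spec_norm A * norm (column j X))\<^sup>2)"
    unfolding norm_power2_sum_column column_matrix_mult
    by (intro sum_mono power_mono spec_norm_bound) simp
  then show "(norm (A ** X))\<^sup>2 \<le> (spec_norm A * norm X)\<^sup>2"
    by (simp add: power_mult_distrib sum_distrib_left norm_power2_sum_column[of X])
qed simp

lemma norm_mult_le_right: "norm (X ** A) \<le> norm X * spec_norm A"
  for A X :: "'d::finite mat"
  using norm_mult_le_left[of "transpose A" "transpose X"]
  by (simp add: matrix_transpose_mul[symmetric] mult.commute)

lemma norm_sandwich_le: "norm (A ** X ** C) \<le> spec_norm A * norm X * spec_norm C"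
  for A X C :: "'d::finite mat"
  by (rule order.trans[OF norm_mult_le_right]) (intro mult_right_mono norm_mult_le_left, simp)

lemma spec_norm_le_norm: "spec_norm A \<le> norm A"
  for A :: "'d::finite mat"
proof (rule spec_norm_leI)
  fix x :: "real^'d"
  show "norm (A *v x) \<le> norm A * norm x"
  proof -
    have "(norm (A *v x))\<^sup>2 = (\<Sum>i\<in>UNIV. (A $ i \<bullet> x)\<^sup>2)"
      unfolding power2_norm_eq_inner
      by (simp add: inner_vec_def matrix_vector_mult_def power2_eq_square)
    also have "\<dots> \<le> (\<Sum>i\<in>UNIV. (norm (A $ i))\<^sup>2 * (norm x)\<^sup>2)"
      by (intro sum_mono) (metis Cauchy_Schwarz_ineq power2_norm_eq_inner)
    also have "\<dots> = (norm A * norm x)\<^sup>2"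
      by (simp add: power_mult_distrib sum_distrib_right norm_power2_sum_row[of A])
    finally show ?thesis by (rule power2_le_imp_le) simp
  qed
qed

text \<open>The factor \<open>norm (mat 1)\<close> is the square root of the dimension; it is
  carried symbolically through all later constants.\<close>

lemma norm_le_spec_norm: "norm A \<le> spec_norm A * norm (mat 1 :: 'd::finite mat)"
  for A :: "'d::finite mat"
  using norm_mult_le_left[of A "mat 1"] by simp

lemma norm_mult_le: "norm (A ** B) \<le> norm A * norm B"
  for A B :: "'d::finite mat"
  using norm_mult_le_left[of A B] mult_right_mono[OF spec_norm_le_norm[of A], of "norm B"] by simp

lemma bounded_bilinear_matrix_mult: "bounded_bilinear ((**) :: 'd::finite mat \<Rightarrow> 'd mat \<Rightarrow> 'd mat)"
proof
  show "\<exists>K. \<forall>(a :: 'd mat) (b :: 'd mat). norm (a ** b) \<le> norm a * norm b * K"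
    by (rule exI[of _ 1]) (simp add: norm_mult_le)
qed (simp_all add: vec_eq_iff matrix_matrix_mult_def sum_distrib_left sum.distrib algebra_simps)

interpretation mm: bounded_bilinear "(**) :: 'd::finite mat \<Rightarrow> 'd mat \<Rightarrow> 'd mat"
  by (rule bounded_bilinear_matrix_mult)

section \<open>Adjoints of matrix multiplication for the Frobenius inner product\<close>

lemma inner_mult_left: "(A ** X) \<bullet> Y = X \<bullet> (transpose A ** Y)"
  for A X Y :: "'d::finite mat"
proof -
  have "(A ** X) \<bullet> Y = (\<Sum>i\<in>UNIV. \<Sum>j\<in>UNIV. \<Sum>k\<in>UNIV. A $ i $ k * X $ k $ j * Y $ i $ j)"
    by (simp add: inner_vec_def matrix_matrix_mult_def sum_distrib_right)
  also have "\<dots> = (\<Sum>i\<in>UNIV. \<Sum>k\<in>UNIV. \<Sum>j\<in>UNIV. A $ i $ k * X $ k $ j * Y $ i $ j)"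
    by (intro sum.cong refl sum.swap)
  also have "\<dots> = (\<Sum>k\<in>UNIV. \<Sum>i\<in>UNIV. \<Sum>j\<in>UNIV. A $ i $ k * X $ k $ j * Y $ i $ j)"
    by (rule sum.swap)
  also have "\<dots> = (\<Sum>k\<in>UNIV. \<Sum>j\<in>UNIV. \<Sum>i\<in>UNIV. A $ i $ k * X $ k $ j * Y $ i $ j)"
    by (intro sum.cong refl sum.swap)
  also have "\<dots> = X \<bullet> (transpose A ** Y)"
    by (simp add: inner_vec_def matrix_matrix_mult_def transpose_def sum_distrib_left mult_ac)
  finally show ?thesis .
qed

lemma inner_transpose: "transpose X \<bullet> transpose Y = X \<bullet> Y"
  for X Y :: "'d::finite mat"
  by (simp add: inner_vec_def transpose_def, rule sum.swap)

lemma inner_mult_right: "(X ** C) \<bullet> Y = X \<bullet> (Y ** transpose C)"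
  for C X Y :: "'d::finite mat"
  using inner_mult_left[of "transpose C" "transpose X" "transpose Y"]
  by (metis inner_transpose matrix_transpose_mul transpose_transpose)

lemma trace_mult_transpose: "trace (X ** transpose Y) = X \<bullet> Y"
  for X Y :: "'d::finite mat"
  by (simp add: trace_def matrix_matrix_mult_def transpose_def inner_vec_def)

lemma sq_sigma_norm_inner: "sq_sigma_norm S X = (X ** S) \<bullet> X"
  by (simp add: sq_sigma_norm_def trace_mult_transpose)

lemma row_mult_symmetric:
  fixes S X :: "'d::finite mat"
  assumes "transpose S = S"
  shows "(X ** S) $ i = S *v (X $ i)"
proof -
  have "(X ** S) $ i = (X $ i) v* S"
    by (simp add: vec_eq_iff matrix_matrix_mult_def vector_matrix_mult_def mult.commute)
  then show ?thesis using assms by (metis vector_transpose_matrix)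
qed

subsection \<open>Rayleigh bounds\<close>

lemma symmetric_inner_commute:
  fixes S :: "'d::finite mat"
  assumes "transpose S = S"
  shows "x \<bullet> (S *v y) = (S *v x) \<bullet> y"
  using assms by (metis dot_lmul_matrix transpose_matrix_vector)

text \<open>Eigenvectors for distinct eigenvalues of a symmetric matrix are orthogonal, hence
  independent. Finiteness is what gives \<open>Min\<close> and \<open>Max\<close> of
  \<open>eigvals S\<close> their meaning.\<close>

lemma finite_eigvals:
  fixes S :: "'d::finite mat"
  assumes S: "transpose S = S"
  shows "finite (eigvals S)"
proof -
  have "\<forall>l\<in>eigvals S. \<exists>v. v \<noteq> 0 \<and> S *v v = l *\<^sub>R v"
    by (simp add: eigvals_def)
  then obtain v where v: "\<And>l. l \<in> eigvals S \<Longrightarrow> v l \<noteq> 0 \<and> S *v (v l) = l *\<^sub>R v l"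
    by (metis (no_types, lifting))
  have orth: "v a \<bullet> v b = 0" if "a \<in> eigvals S" "b \<in> eigvals S" "a \<noteq> b" for a b
  proof -
    have "b * (v a \<bullet> v b) = a * (v a \<bullet> v b)"
      using symmetric_inner_commute[OF S, of "v a" "v b"] v that by simp
    then show ?thesis using that by simp
  qed
  have inj: "inj_on v (eigvals S)"
    by (rule inj_onI) (metis orth inner_eq_zero_iff v)
  have "independent (v ` eigvals S)"
    by (rule pairwise_orthogonal_independent)
      (use orth v in \<open>auto simp: pairwise_def orthogonal_def\<close>)
  then show ?thesis using inj finite_imageD independent_imp_finite by blast
qed

text \<open>The quadratic form attains its minimum on the compact unit sphere, and the first-order
  condition at the minimiser is the eigenvector equation. The defect of that equation is called
  \<open>w\<close> and is shown to vanish.\<close>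

lemma minimal_rayleigh_quotient_eigval:
  fixes S :: "'d::finite mat"
  assumes S: "transpose S = S"
  obtains l where "l \<in> eigvals S" "\<And>x. l * (x \<bullet> x) \<le> x \<bullet> (S *v x)"
proof -
  let ?q = "\<lambda>x::real^'d. x \<bullet> (S *v x)"
  have cont: "continuous_on (sphere 0 1) ?q"
    by (intro continuous_intros linear_continuous_on) simp
  have "axis undefined 1 \<in> sphere (0::real^'d) 1" by simp
  then have "sphere (0::real^'d) 1 \<noteq> {}" by blast
  with continuous_attains_inf[OF compact_sphere _ cont]
  obtain v where v: "norm v = 1" "\<And>y. norm y = 1 \<Longrightarrow> ?q v \<le> ?q y" by auto
  define l where "l = ?q v"
  have ray: "l * (x \<bullet> x) \<le> ?q x" for x
  proof (cases "x = 0")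
    case False
    have "l \<le> ?q (x /\<^sub>R norm x)" unfolding l_def by (rule v(2)) (use False in simp)
    also have "\<dots> = ?q x / (norm x)\<^sup>2"
      using False by (simp add: matrix_vector_mult_scaleR power2_eq_square divide_inverse)
    finally show ?thesis using False
      by (simp add: power2_norm_eq_inner[symmetric] field_simps)
  qed simp
  define w where "w = S *v v - l *\<^sub>R v"
  define b where "b = ?q w - l * (w \<bullet> w)"
  have vv: "v \<bullet> v = 1" using v(1) by (simp add: power2_norm_eq_inner[symmetric])
  \<comment> \<open>Moving the minimiser in the direction of its own defect makes the first-order
    term exactly \<open>2 * t * (w \<bullet> w)\<close>.\<close>
  have quad: "0 \<le> 2 * t * (w \<bullet> w) + t\<^sup>2 * b" for t
  proof -
    have "l * ((v + t *\<^sub>R w) \<bullet> (v + t *\<^sub>R w)) \<le> ?q (v + t *\<^sub>R w)" by (rule ray)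
    moreover have "?q (v + t *\<^sub>R w) = l + 2 * t * (w \<bullet> (S *v v)) + t\<^sup>2 * ?q w"
      using symmetric_inner_commute[OF S, of v w]
      by (simp add: l_def matrix_vector_right_distrib matrix_vector_mult_scaleR inner_add_left
          inner_add_right power2_eq_square inner_commute algebra_simps)
    moreover have "l * ((v + t *\<^sub>R w) \<bullet> (v + t *\<^sub>R w)) = l + 2 * t * (l * (w \<bullet> v)) + t\<^sup>2 * (l * (w \<bullet> w))"
      by (simp add: vv inner_add_left inner_add_right power2_eq_square inner_commute algebra_simps)
    moreover have "w \<bullet> w = w \<bullet> (S *v v) - l * (w \<bullet> v)"
      by (subst (2) w_def) (simp add: inner_diff_right)
    then have "2 * t * (w \<bullet> w) = 2 * t * (w \<bullet> (S *v v)) - 2 * t * (l * (w \<bullet> v))"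
      by (simp only: right_diff_distrib)
    ultimately show ?thesis unfolding b_def right_diff_distrib by linarith
  qed
  have "w \<bullet> w = 0"
  proof (rule ccontr)
    assume "w \<bullet> w \<noteq> 0"
    then have pos: "0 < w \<bullet> w" by (simp add: less_le)
    \<comment> \<open>Negative, and small enough that the quadratic term offsets at most half of the
      linear one.\<close>
    define t where "t = - (w \<bullet> w) / (1 + \<bar>b\<bar>)"
    have "t\<^sup>2 * b \<le> t\<^sup>2 * (1 + \<bar>b\<bar>)" by (intro mult_left_mono) auto
    also have "\<dots> = - t * (w \<bullet> w)"
      by (simp add: t_def power2_eq_square field_simps add_nonneg_eq_0_iff)
    finally have "0 \<le> t * (w \<bullet> w)" using quad[of t] by simp
    moreover have "t < 0" using pos by (simp add: t_def divide_neg_pos add_pos_nonneg)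
    ultimately show False using pos by (simp add: zero_le_mult_iff)
  qed
  then have "l \<in> eigvals S" using vv by (auto simp: eigvals_def w_def intro!: exI[of _ v])
  then show ?thesis using ray that by blast
qed

text \<open>Turns the upper Rayleigh bound into the lower one for \<open>- S\<close>.\<close>

lemma eigvals_uminus: "l \<in> eigvals (- S) \<longleftrightarrow> - l \<in> eigvals S"
  for S :: "'d::finite mat"
proof -
  have "(- S) *v v = - (S *v v)" for v
    by (simp add: vec_eq_iff matrix_vector_mult_def sum_negf)
  then show ?thesis unfolding eigvals_def mem_Collect_eq scaleR_minus_left
    by (metis minus_equation_iff)
qed

lemma rayleigh_bounds:
  fixes S :: "'d::finite mat"
  assumes "sym_pos_def S"
  shows "0 < Min (eigvals S)" "0 < Max (eigvals S)"
    "Min (eigvals S) * (x \<bullet> x) \<le> x \<bullet> (S *v x)"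
    "x \<bullet> (S *v x) \<le> Max (eigvals S) * (x \<bullet> x)"
proof -
  have S: "transpose S = S" and pos: "\<And>x. x \<noteq> 0 \<Longrightarrow> 0 < x \<bullet> (S *v x)"
    using assms by (auto simp: sym_pos_def_def)
  note fin = finite_eigvals[OF S]
  obtain l where l: "l \<in> eigvals S" "\<And>x. l * (x \<bullet> x) \<le> x \<bullet> (S *v x)"
    using minimal_rayleigh_quotient_eigval[OF S] by blast
  have "transpose (- S) = - S" using S by (simp add: transpose_def vec_eq_iff)
  then obtain u where u: "u \<in> eigvals (- S)" "\<And>x. u * (x \<bullet> x) \<le> x \<bullet> ((- S) *v x)"
    using minimal_rayleigh_quotient_eigval by blast
  have neg: "x \<bullet> ((- S) *v x) = - (x \<bullet> (S *v x))" for x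
    by (simp add: inner_vec_def matrix_vector_mult_def sum_negf)
  have evpos: "0 < k" if "k \<in> eigvals S" for k
  proof -
    from that obtain v where v: "v \<noteq> 0" "S *v v = k *\<^sub>R v" by (auto simp: eigvals_def)
    with pos[of v] have "0 < k * (v \<bullet> v)" by simp
    then show ?thesis using inner_ge_zero[of v] by (simp add: zero_less_mult_iff not_less)
  qed
  show "0 < Min (eigvals S)" "0 < Max (eigvals S)"
    using evpos Min_in[OF fin] Max_in[OF fin] l by blast+
  have "Min (eigvals S) * (x \<bullet> x) \<le> l * (x \<bullet> x)"
    by (intro mult_right_mono Min_le fin l) simp
  with l(2)[of x] show "Min (eigvals S) * (x \<bullet> x) \<le> x \<bullet> (S *v x)" by simp
  have "(- u) * (x \<bullet> x) \<le> Max (eigvals S) * (x \<bullet> x)"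
    using u(1) by (intro mult_right_mono Max_ge fin) (simp_all add: eigvals_uminus)
  with u(2)[of x] show "x \<bullet> (S *v x) \<le> Max (eigvals S) * (x \<bullet> x)" by (simp add: neg)
qed

section \<open>Inequalities for the quadratic form and the weighted matrix norm\<close>

locale spd_bounds =
  fixes S :: "'d::finite mat" and m M :: real
  assumes sym: "transpose S = S" and m_pos: "0 < m" and M_pos: "0 < M"
    and rayleigh_lower: "m * (x \<bullet> x) \<le> x \<bullet> (S *v x)"
    and rayleigh_upper: "x \<bullet> (S *v x) \<le> M * (x \<bullet> x)"
begin

lemma quad_nonneg: "0 \<le> x \<bullet> (S *v x)"
  using rayleigh_lower[of x] m_pos by (meson inner_ge_zero order.trans mult_nonneg_nonneg less_imp_le)

lemma quad_Cauchy_Schwarz: "(x \<bullet> (S *v y))\<^sup>2 \<le> (x \<bullet> (S *v x)) * (y \<bullet> (S *v y))"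
proof -
  have quad: "0 \<le> x \<bullet> (S *v x) + 2 * t * (x \<bullet> (S *v y)) + t\<^sup>2 * (y \<bullet> (S *v y))" for t
    using quad_nonneg[of "x + t *\<^sub>R y"] symmetric_inner_commute[OF sym, of x y]
    by (simp add: matrix_vector_right_distrib matrix_vector_mult_scaleR inner_add_left
          inner_add_right power2_eq_square inner_commute algebra_simps)
  show ?thesis
  proof (cases "y = 0")
    case False
    then have pos: "0 < y \<bullet> (S *v y)"
      using rayleigh_lower[of y] m_pos by (meson inner_gt_zero_iff mult_pos_pos order_less_le_trans)
    show ?thesis
      \<comment> \<open>This parameter minimises the quadratic polynomial in
        \<open>t\<close>.\<close>
      using quad[of "- (x \<bullet> (S *v y)) / (y \<bullet> (S *v y))"] pos
      by (simp add: power2_eq_square field_simps)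
  qed simp
qed

text \<open>Cauchy-Schwarz combined with the lower Rayleigh bound replaces the square root of
  \<open>S\<close>. Working with \<open>x \<bullet> (S *v x)\<close> instead of
  \<open>x \<bullet> x\<close> costs a single factor \<open>m\<close>, as the decay rate
  requires.\<close>

lemma norm_mult_vec_lower: "m * (x \<bullet> (S *v x)) \<le> (norm (S *v x))\<^sup>2"
proof (cases "x = 0")
  case False
  let ?a = "x \<bullet> (S *v x)"
  have pos: "0 < ?a"
    using False rayleigh_lower[of x] m_pos by (meson inner_gt_zero_iff mult_pos_pos order_less_le_trans)
  have "m * (?a * ?a) \<le> m * ((x \<bullet> x) * (norm (S *v x))\<^sup>2)"
    using m_pos Cauchy_Schwarz_ineq[of x "S *v x"]
    by (simp add: power2_eq_square[symmetric] power2_norm_eq_inner)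
  also have "\<dots> = (m * (x \<bullet> x)) * (norm (S *v x))\<^sup>2" by simp
  also have "\<dots> \<le> ?a * (norm (S *v x))\<^sup>2"
    by (intro mult_right_mono rayleigh_lower) simp
  finally have "(m * ?a) * ?a \<le> (norm (S *v x))\<^sup>2 * ?a" by (simp add: mult_ac)
  with pos show ?thesis by (simp add: mult_le_cancel_right)
qed simp

text \<open>Cauchy-Schwarz for the form itself, applied to \<open>x\<close> and
  \<open>S *v x\<close>.\<close>

lemma norm_mult_vec_upper: "(norm (S *v x))\<^sup>2 \<le> M * (x \<bullet> (S *v x))"
proof (cases "norm (S *v x) = 0")
  case True
  then show ?thesis using quad_nonneg[of x] M_pos by simp
next
  case False
  let ?y = "S *v x"
  have "(norm ?y)\<^sup>2 * (norm ?y)\<^sup>2 = (x \<bullet> (S *v ?y))\<^sup>2"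
    using symmetric_inner_commute[OF sym, of x ?y] by (simp add: power2_norm_eq_inner power2_eq_square[of "_ \<bullet> _"])
  also have "\<dots> \<le> (x \<bullet> ?y) * (?y \<bullet> (S *v ?y))" by (rule quad_Cauchy_Schwarz)
  also have "\<dots> \<le> (x \<bullet> ?y) * (M * (norm ?y)\<^sup>2)"
    using rayleigh_upper[of ?y] by (intro mult_left_mono quad_nonneg) (simp add: power2_norm_eq_inner)
  finally have "(norm ?y)\<^sup>2 * (norm ?y)\<^sup>2 \<le> (M * (x \<bullet> ?y)) * (norm ?y)\<^sup>2" by (simp add: mult_ac)
  then show ?thesis by (rule mult_right_le_imp_le) (use False in simp)
qed

text \<open>The weighted norm splits into the quadratic forms of the rows, so every vector
  inequality above lifts to matrices by summation.\<close>

lemma sigma_inner_rows: "(X ** S) \<bullet> X = (\<Sum>i\<in>UNIV. X $ i \<bullet> (S *v (X $ i)))"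
  for X :: "'d mat"
  by (subst inner_vec_def) (simp only: row_mult_symmetric[OF sym] inner_commute)

lemma sigma_norm_nonneg: "0 \<le> (X ** S) \<bullet> X"
  for X :: "'d mat"
  unfolding sigma_inner_rows by (intro sum_nonneg quad_nonneg)

lemma sigma_norm_lower: "m * (norm X)\<^sup>2 \<le> (X ** S) \<bullet> X"
  for X :: "'d mat"
  unfolding sigma_inner_rows norm_power2_sum_row sum_distrib_left
  by (intro sum_mono) (simp add: power2_norm_eq_inner rayleigh_lower)

lemma sigma_norm_upper: "(X ** S) \<bullet> X \<le> M * (norm X)\<^sup>2"
  for X :: "'d mat"
  unfolding sigma_inner_rows norm_power2_sum_row sum_distrib_left
  by (intro sum_mono) (simp add: power2_norm_eq_inner rayleigh_upper)

lemma norm_mult_sigma_lower: "m * ((X ** S) \<bullet> X) \<le> (norm (X ** S))\<^sup>2"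
  for X :: "'d mat"
  unfolding sigma_inner_rows norm_power2_sum_row sum_distrib_left row_mult_symmetric[OF sym]
  by (intro sum_mono norm_mult_vec_lower)

lemma norm_mult_sigma_upper: "(norm (X ** S))\<^sup>2 \<le> M * ((X ** S) \<bullet> X)"
  for X :: "'d mat"
  unfolding sigma_inner_rows norm_power2_sum_row sum_distrib_left row_mult_symmetric[OF sym]
  by (intro sum_mono norm_mult_vec_upper)

lemma norm_mult_sigma_le: "norm (X ** S) \<le> M * norm X"
  for X :: "'d mat"
proof (rule power2_le_imp_le)
  have "(norm (X ** S))\<^sup>2 \<le> M * (M * (norm X)\<^sup>2)"
    by (rule order.trans[OF norm_mult_sigma_upper mult_left_mono[OF sigma_norm_upper]])
      (use M_pos in simp)
  then show "(norm (X ** S))\<^sup>2 \<le> (M * norm X)\<^sup>2" by (simp add: power2_eq_square mult_ac)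
qed (use M_pos in simp)

lemma norm_mult_sigma_ge: "m * norm X \<le> norm (X ** S)"
  for X :: "'d mat"
proof (rule power2_le_imp_le)
  have "m * (m * (norm X)\<^sup>2) \<le> (norm (X ** S))\<^sup>2"
    by (rule order.trans[OF mult_left_mono[OF sigma_norm_lower] norm_mult_sigma_lower])
      (use m_pos in simp)
  then show "(m * norm X)\<^sup>2 \<le> (norm (X ** S))\<^sup>2" by (simp add: power2_eq_square mult_ac)
qed simp

lemma sigma_inner_commute: "(X ** S) \<bullet> Y = (Y ** S) \<bullet> X"
  for X Y :: "'d mat"
  by (metis inner_commute inner_mult_right sym)

end

section \<open>Products of residual layers\<close>

text \<open>Ordered product over the half-open range from \<open>i\<close> to \<open>j\<close>,
  later layers on the left. Empty ranges give the identity, so splitting at an intermediate index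
  has no boundary cases.\<close>

fun seg :: "(nat \<Rightarrow> 'd::finite mat) \<Rightarrow> nat \<Rightarrow> nat \<Rightarrow> 'd mat" where
  "seg f i 0 = mat 1"
| "seg f i (Suc j) = (if i \<le> j then f j ** seg f i j else mat 1)"

lemma seg_trivial [simp]: "j \<le> i \<Longrightarrow> seg f i j = mat 1"
  by (cases j) auto

lemma seg_Suc: "i \<le> j \<Longrightarrow> seg f i (Suc j) = f j ** seg f i j"
  by simp

declare seg.simps(2) [simp del]

lemma seg_compose: "i \<le> j \<Longrightarrow> j \<le> l \<Longrightarrow> seg f j l ** seg f i j = seg f i l"
  by (induction l) (auto simp: seg_Suc le_Suc_eq matrix_mul_assoc[symmetric])

lemma seg_Suc_left: "i < j \<Longrightarrow> seg f i j = seg f (Suc i) j ** f i"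
  using seg_compose[of i "Suc i" j f] by (simp add: seg_Suc)

text \<open>Layers are numbered from 0 and parameters from 1; with zero-based layers the block
  containing \<open>j\<close> is simply \<open>j div k\<close>.\<close>

definition layer :: "nat \<Rightarrow> (nat \<Rightarrow> 'd::finite mat) \<Rightarrow> nat \<Rightarrow> 'd mat" where
  "layer N th i = mat 1 + (1 / real N) *\<^sub>R th (Suc i)"

lemma resprod_eq_seg: "resprod N th j = seg (layer N th) 0 j"
  by (induction j) (simp_all add: seg_Suc layer_def)

lemma one_plus_power_le_exp: "0 \<le> x \<Longrightarrow> (1 + x) ^ n \<le> exp (real n * x)"
  for x :: real
  by (metis add_nonneg_nonneg exp_ge_add_one_self exp_of_nat_mult power_mono zero_le_one)

lemma exp_half_le_2: "exp (1/2 :: real) \<le> 2"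
proof -
  have "(exp (1/2 :: real))\<^sup>2 \<le> 2\<^sup>2"
    using exp_le by (simp add: exp_double[symmetric])
  then show ?thesis by (rule power2_le_imp_le) simp
qed

text \<open>The bound 1/2 is twice the initial bound 1/4; it is the region in which the flow is
  later shown to remain.\<close>

locale small_layers =
  fixes N :: nat and th :: "nat \<Rightarrow> 'd::finite mat"
  assumes N_ge_1: "1 \<le> N"
    and small: "\<And>i. i < N \<Longrightarrow> spec_norm (th (Suc i)) \<le> 1/2"
begin

abbreviation F where "F \<equiv> layer N th"

lemma N_pos: "0 < real N"
  using N_ge_1 by simp

lemma power_le_exp_half: "n \<le> N \<Longrightarrow> (1 + 1 / (2 * real N)) ^ n \<le> exp (1/2)"
proof -
  assume n: "n \<le> N"
  have "(1 + 1 / (2 * real N)) ^ n \<le> exp (real n * (1 / (2 * real N)))"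
    by (rule one_plus_power_le_exp) simp
  also have "\<dots> \<le> exp (1/2)" using n N_pos by (simp add: field_simps)
  finally show ?thesis .
qed

lemma spec_norm_step: "i < N \<Longrightarrow> spec_norm ((1 / real N) *\<^sub>R th (Suc i)) \<le> 1 / (2 * real N)"
  using small[of i] N_pos by (simp add: spec_norm_scaleR field_simps)

lemma spec_norm_layer: "i < N \<Longrightarrow> spec_norm (F i) \<le> 1 + 1 / (2 * real N)"
  unfolding layer_def
  by (rule order.trans[OF spec_norm_add_le]) (intro add_mono spec_norm_one_le spec_norm_step)

text \<open>The exact exponent is retained because the two segments around a layer are later
  multiplied. Bounding each of them by 2 would make the travelled distance too large for the
  bootstrap.\<close>

lemma spec_norm_seg_power:
  "i \<le> j \<Longrightarrow> j \<le> N \<Longrightarrow> spec_norm (seg F i j) \<le> (1 + 1 / (2 * real N)) ^ (j - i)"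
proof (induction j rule: dec_induct)
  case base
  show ?case by (simp add: spec_norm_one_le)
next
  case (step j)
  have "spec_norm (seg F i (Suc j)) \<le> spec_norm (F j) * spec_norm (seg F i j)"
    using step by (simp add: seg_Suc spec_norm_mult_le)
  also have "\<dots> \<le> (1 + 1 / (2 * real N)) * (1 + 1 / (2 * real N)) ^ (j - i)"
    using step by (intro mult_mono spec_norm_layer step.IH) auto
  finally show ?case using step by (simp add: Suc_diff_le)
qed

lemma spec_norm_seg: "i \<le> j \<Longrightarrow> j \<le> N \<Longrightarrow> spec_norm (seg F i j) \<le> 2"
  using spec_norm_seg_power[of i j] power_le_exp_half[of "j - i"] exp_half_le_2 by linarith

lemma spec_norm_seg_diff_one:
  "i \<le> j \<Longrightarrow> j \<le> N \<Longrightarrow> spec_norm (seg F i j - mat 1) \<le> real (j - i) / real N"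
proof (induction j rule: dec_induct)
  case base
  show ?case by simp
next
  case (step j)
  have eq: "seg F i (Suc j) - mat 1 = (seg F i j - mat 1) + (1 / real N) *\<^sub>R th (Suc j) ** seg F i j"
    using step by (simp add: seg_Suc layer_def mm.add_left)
  have "spec_norm ((1 / real N) *\<^sub>R th (Suc j) ** seg F i j) \<le> 1 / (2 * real N) * 2"
    using step by (intro order.trans[OF spec_norm_mult_le] mult_mono spec_norm_step spec_norm_seg) auto
  then have "spec_norm (seg F i (Suc j) - mat 1) \<le> real (j - i) / real N + 1 / real N"
    unfolding eq using step by (intro order.trans[OF spec_norm_add_le] add_mono) auto
  also have "\<dots> = real (Suc j - i) / real N"
    using step N_pos by (simp add: Suc_diff_le field_simps)
  finally show ?case .
qed

text \<open>One more layer adds its parameter times \<open>seg F i j - mat 1\<close>, a term of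
  second order that fits into the increment of the square. The resulting error depends only on the
  fraction of depth covered, not on the number of layers.\<close>

lemma spec_norm_seg_first_order:
  "i \<le> j \<Longrightarrow> j \<le> N \<Longrightarrow>
    spec_norm (seg F i j - mat 1 - (1 / real N) *\<^sub>R (\<Sum>l=i..<j. th (Suc l))) \<le> (real (j - i) / real N)\<^sup>2"
proof (induction j rule: dec_induct)
  case base
  show ?case by simp
next
  case (step j)
  let ?R = "\<lambda>j. seg F i j - mat 1 - (1 / real N) *\<^sub>R (\<Sum>l=i..<j. th (Suc l))"
  have eq: "?R (Suc j) = ?R j + (1 / real N) *\<^sub>R th (Suc j) ** (seg F i j - mat 1)"
    using step by (simp add: seg_Suc layer_def mm.add_left mm.diff_right scaleR_add_right)
  have "spec_norm ((1 / real N) *\<^sub>R th (Suc j) ** (seg F i j - mat 1)) \<le> 1 / (2 * real N) * (real (j - i) / real N)"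
    using step by (intro order.trans[OF spec_norm_mult_le] mult_mono spec_norm_step spec_norm_seg_diff_one) auto
  then have "spec_norm (?R (Suc j)) \<le> (real (j - i) / real N)\<^sup>2 + 1 / (2 * real N) * (real (j - i) / real N)"
    unfolding eq using step by (intro order.trans[OF spec_norm_add_le] add_mono) auto
  also have "\<dots> \<le> (real (j - i) / real N + 1 / real N)\<^sup>2"
    using N_pos by (simp add: power2_eq_square field_simps)
  also have "real (j - i) / real N + 1 / real N = real (Suc j - i) / real N"
    using step N_pos by (simp add: Suc_diff_le field_simps)
  finally show ?case .
qed

lemma spec_norm_seg_shift_left:
  assumes "i \<le> i'" "i' \<le> j" "j \<le> N"
  shows "spec_norm (seg F i j - seg F i' j) \<le> 2 * (real (i' - i) / real N)"
proof -
  have "seg F i j - seg F i' j = seg F i' j ** (seg F i i' - mat 1)"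
    using seg_compose[of i i' j F] assms by (simp add: mm.diff_right)
  also have "spec_norm \<dots> \<le> 2 * (real (i' - i) / real N)"
    using assms by (intro order.trans[OF spec_norm_mult_le] mult_mono spec_norm_seg spec_norm_seg_diff_one) auto
  finally show ?thesis .
qed

lemma spec_norm_seg_shift_right:
  assumes "i \<le> j" "j \<le> j'" "j' \<le> N"
  shows "spec_norm (seg F i j' - seg F i j) \<le> 2 * (real (j' - j) / real N)"
proof -
  have "seg F i j' - seg F i j = (seg F j j' - mat 1) ** seg F i j"
    using seg_compose[of i j j' F] assms by (simp add: mm.diff_left)
  also have "spec_norm \<dots> \<le> (real (j' - j) / real N) * 2"
    using assms by (intro order.trans[OF spec_norm_mult_le] mult_mono spec_norm_seg spec_norm_seg_diff_one) auto
  finally show ?thesis by (simp add: mult.commute)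
qed

definition outer where "outer i = seg F (Suc i) N"
definition inner_seg where "inner_seg i = seg F 0 i"
text \<open>The Frobenius adjoint of \<open>H \<mapsto> outer i ** H ** inner_seg i\<close>: it
  carries a gradient at the output back to layer \<open>i\<close>.\<close>

definition backprop :: "nat \<Rightarrow> 'd mat \<Rightarrow> 'd mat" where "backprop i X = transpose (outer i) ** X ** transpose (inner_seg i)"

lemma spec_norm_outer: "i < N \<Longrightarrow> spec_norm (outer i) \<le> 2"
  unfolding outer_def by (rule spec_norm_seg) auto

lemma spec_norm_inner_seg: "i < N \<Longrightarrow> spec_norm (inner_seg i) \<le> 2"
  unfolding inner_seg_def by (rule spec_norm_seg) auto

lemma norm_backprop_upper:
  fixes X :: "'d mat"
  assumes i: "i < N"
  shows "norm (backprop i X) \<le> exp (1/2) * norm X"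
proof -
  let ?p = "1 + 1 / (2 * real N)"
  have "norm (backprop i X) \<le> spec_norm (outer i) * norm X * spec_norm (inner_seg i)"
    unfolding backprop_def using norm_sandwich_le[of "transpose (outer i)" X "transpose (inner_seg i)"] by simp
  also have "\<dots> \<le> ?p ^ (N - Suc i) * norm X * ?p ^ i"
    unfolding outer_def inner_seg_def using i spec_norm_seg_power[of 0 i]
    by (intro mult_mono spec_norm_seg_power) auto
  also have "\<dots> = ?p ^ (N - 1) * norm X"
    using i power_add[of ?p "N - Suc i" i] by simp
  also have "\<dots> \<le> exp (1/2) * norm X"
    by (intro mult_right_mono power_le_exp_half) auto
  finally show ?thesis .
qed

text \<open>Inverting gives \<open>(1 + 1 / (2 * real N - 1)) ^ (N - 1)\<close>, whose exponent
  estimate is at most 1/2. The exponent \<open>N - 1\<close> matters: with \<open>N\<close> factors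
  the bound would fail.\<close>

lemma one_minus_power_ge: "exp (- (1/2)) \<le> (1 - 1 / (2 * real N)) ^ (N - 1)"
proof -
  let ?y = "1 / (2 * real N - 1)"
  have pos: "0 < 2 * real N - 1" using N_ge_1 by simp
  have "(1 + ?y) ^ (N - 1) \<le> exp (real (N - 1) * ?y)"
    using pos by (intro one_plus_power_le_exp) simp
  also have "\<dots> \<le> exp (1/2)"
    using pos N_ge_1 by (simp add: of_nat_diff field_simps)
  finally have "inverse (exp (1/2)) \<le> inverse ((1 + ?y) ^ (N - 1))"
    using pos by (intro le_imp_inverse_le zero_less_power) (simp_all add: add_pos_pos)
  moreover have "inverse (1 + ?y) = 1 - 1 / (2 * real N)"
    using pos N_pos by (simp add: field_simps)
  ultimately show ?thesis by (simp add: power_inverse[symmetric] exp_minus)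
qed

text \<open>The reverse triangle inequality bounds the layer from below without constructing an
  inverse.\<close>

lemma norm_transpose_layer_mult_ge:
  fixes X :: "'d mat"
  assumes i: "i < N"
  shows "(1 - 1 / (2 * real N)) * norm X \<le> norm (transpose (F i) ** X)"
proof -
  have tr: "transpose (F i) ** X = X + transpose ((1 / real N) *\<^sub>R th (Suc i)) ** X"
    by (simp add: layer_def transpose_def vec_eq_iff matrix_matrix_mult_def mat_def sum.distrib
        algebra_simps if_distrib[of "\<lambda>x. _ * x"] cong: if_cong)
  have "norm (transpose ((1 / real N) *\<^sub>R th (Suc i)) ** X) \<le> 1 / (2 * real N) * norm X"
    using spec_norm_step[OF i] by (intro order.trans[OF norm_mult_le_left] mult_right_mono) auto
  then show ?thesis unfolding tr
    using norm_triangle_ineq4[of "X + transpose ((1 / real N) *\<^sub>R th (Suc i)) ** X" "transpose ((1 / real N) *\<^sub>R th (Suc i)) ** X"]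
    by (simp add: algebra_simps)
qed

lemma norm_mult_transpose_layer_ge:
  fixes X :: "'d mat"
  assumes i: "i < N"
  shows "(1 - 1 / (2 * real N)) * norm X \<le> norm (X ** transpose (F i))"
proof -
  have tr: "X ** transpose (F i) = X + X ** transpose ((1 / real N) *\<^sub>R th (Suc i))"
    by (simp add: layer_def transpose_def vec_eq_iff matrix_matrix_mult_def mat_def sum.distrib
        algebra_simps if_distrib[of "\<lambda>x. _ * x"] cong: if_cong)
  have "norm (X ** transpose ((1 / real N) *\<^sub>R th (Suc i))) \<le> norm X * (1 / (2 * real N))"
    using spec_norm_step[OF i] by (intro order.trans[OF norm_mult_le_right] mult_left_mono) auto
  then show ?thesis unfolding tr
    using norm_triangle_ineq4[of "X + X ** transpose ((1 / real N) *\<^sub>R th (Suc i))" "X ** transpose ((1 / real N) *\<^sub>R th (Suc i))"]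
    by (simp add: algebra_simps)
qed

lemma layer_factor_nonneg: "0 \<le> 1 - 1 / (2 * real N)"
  using N_ge_1 by (simp add: field_simps)

text \<open>Transposition reverses the order, so the last layer meets \<open>X\<close> first; the
  induction must therefore range over all \<open>X\<close>. In the mirrored statement below the last
  layer is outermost and \<open>X\<close> stays fixed.\<close>

lemma norm_transpose_seg_mult_ge:
  "i \<le> j \<Longrightarrow> j \<le> N \<Longrightarrow> (1 - 1 / (2 * real N)) ^ (j - i) * norm X \<le> norm (transpose (seg F i j) ** X)"
  for X :: "'d mat"
proof (induction j arbitrary: X rule: dec_induct)
  case (step j)
  let ?p = "1 - 1 / (2 * real N)"
  have "?p ^ (Suc j - i) * norm X = ?p ^ (j - i) * (?p * norm X)"
    using step by (simp add: Suc_diff_le)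
  also have "\<dots> \<le> ?p ^ (j - i) * norm (transpose (F j) ** X)"
    using step by (intro mult_left_mono norm_transpose_layer_mult_ge zero_le_power layer_factor_nonneg) auto
  also have "\<dots> \<le> norm (transpose (seg F i j) ** (transpose (F j) ** X))"
    using step by (intro step.IH) auto
  also have "\<dots> = norm (transpose (seg F i (Suc j)) ** X)"
    using step by (simp add: seg_Suc matrix_transpose_mul matrix_mul_assoc)
  finally show ?case .
qed simp

lemma norm_mult_transpose_seg_ge:
  "i \<le> j \<Longrightarrow> j \<le> N \<Longrightarrow> (1 - 1 / (2 * real N)) ^ (j - i) * norm X \<le> norm (X ** transpose (seg F i j))"
  for X :: "'d mat"
proof (induction j rule: dec_induct)
  case (step j)
  let ?p = "1 - 1 / (2 * real N)"
  have "?p ^ (Suc j - i) * norm X = ?p * (?p ^ (j - i) * norm X)"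
    using step by (simp add: Suc_diff_le)
  also have "\<dots> \<le> ?p * norm (X ** transpose (seg F i j))"
    using step by (intro mult_left_mono step.IH layer_factor_nonneg) auto
  also have "\<dots> \<le> norm (X ** transpose (seg F i j) ** transpose (F j))"
    using step by (intro norm_mult_transpose_layer_ge) auto
  also have "\<dots> = norm (X ** transpose (seg F i (Suc j)))"
    using step by (simp add: seg_Suc matrix_transpose_mul matrix_mul_assoc)
  finally show ?case .
qed simp

lemma norm_backprop_lower:
  fixes X :: "'d mat"
  assumes i: "i < N"
  shows "exp (- (1/2)) * norm X \<le> norm (backprop i X)"
proof -
  let ?p = "1 - 1 / (2 * real N)"
  have "exp (- (1/2)) * norm X \<le> ?p ^ (N - 1) * norm X"
    by (intro mult_right_mono one_minus_power_ge) simp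
  also have "\<dots> = ?p ^ i * (?p ^ (N - Suc i) * norm X)"
    using i power_add[of ?p i "N - Suc i"] by simp
  also have "\<dots> \<le> ?p ^ i * norm (transpose (outer i) ** X)"
    unfolding outer_def using i
    by (intro mult_left_mono norm_transpose_seg_mult_ge zero_le_power layer_factor_nonneg) auto
  also have "\<dots> \<le> norm (backprop i X)"
    unfolding backprop_def inner_seg_def
    using norm_mult_transpose_seg_ge[of 0 i "transpose (outer i) ** X"] i by simp
  finally show ?thesis .
qed

lemma spec_norm_outer_Suc_diff: "Suc i < N \<Longrightarrow> spec_norm (outer (Suc i) - outer i) \<le> 2 / real N"
  unfolding outer_def using spec_norm_seg_shift_left[of "Suc i" "Suc (Suc i)" N]
  by (simp add: spec_norm_minus_commute)

lemma spec_norm_inner_seg_Suc_diff: "i < N \<Longrightarrow> spec_norm (inner_seg (Suc i) - inner_seg i) \<le> 2 / real N"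
  unfolding inner_seg_def using spec_norm_seg_shift_right[of 0 i "Suc i"] by simp

end

section \<open>Layer products at depths N and Nk with parameters D apart\<close>

locale refined_layers =
  coarse: small_layers N th + fine: small_layers "N * k" th'
  for N k :: nat and th th' :: "nat \<Rightarrow> 'd::finite mat" +
  fixes D :: real
  assumes close: "\<And>j. j < N * k \<Longrightarrow> spec_norm (th' (Suc j) - th (Suc (j div k))) \<le> D"
begin

lemma k_pos: "0 < k"
  using fine.N_ge_1 by (cases k) auto

lemma D_nonneg: "0 \<le> D"
  using close[of 0] fine.N_ge_1 spec_norm_nonneg order.trans by (metis less_eq_Suc_le One_nat_def)

text \<open>To first order a block of \<open>k\<close> fine layers acts through the average of its
  parameters, which is within \<open>D\<close> of the coarse one. The quadratic remainder sees only
  the block depth 1/N, hence is independent of \<open>k\<close>.\<close>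

lemma spec_norm_block_diff:
  assumes i: "i < N"
  shows "spec_norm (seg fine.F (i * k) (Suc i * k) - coarse.F i) \<le> D / real N + 1 / (real N)\<^sup>2"
proof -
  let ?e = "1 / real (N * k)"
  let ?S = "\<Sum>l=i*k..<Suc i * k. th' (Suc l)"
  have le: "Suc i * k \<le> N * k" using i by (intro mult_right_mono) auto
  have 1: "spec_norm (seg fine.F (i * k) (Suc i * k) - mat 1 - ?e *\<^sub>R ?S) \<le> 1 / (real N)\<^sup>2"
    using fine.spec_norm_seg_first_order[of "i * k" "Suc i * k"] le k_pos
    by (simp add: power_divide)
  have "(\<Sum>l=i*k..<Suc i * k. th' (Suc l) - th (Suc i)) = ?S - real k *\<^sub>R th (Suc i)"
    by (simp add: sum_subtractf sum_constant_scaleR del: sum_constant)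
  then have eq: "?e *\<^sub>R ?S - (1 / real N) *\<^sub>R th (Suc i)
      = ?e *\<^sub>R (\<Sum>l=i*k..<Suc i * k. th' (Suc l) - th (Suc i))"
    using k_pos by (simp add: scaleR_diff_right)
  have "spec_norm (\<Sum>l=i*k..<Suc i * k. th' (Suc l) - th (Suc i)) \<le> (\<Sum>l=i*k..<Suc i * k. D)"
  proof (rule order.trans[OF spec_norm_sum_le sum_mono])
    fix l assume l: "l \<in> {i*k..<Suc i * k}"
    then have "l div k = i" by (intro div_nat_eqI) (auto simp: mult.commute)
    with close[of l] l le show "spec_norm (th' (Suc l) - th (Suc i)) \<le> D" by auto
  qed
  also have "\<dots> = real k * D" by simp
  finally have 2: "spec_norm (?e *\<^sub>R ?S - (1 / real N) *\<^sub>R th (Suc i)) \<le> D / real N"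
    unfolding eq spec_norm_scaleR using k_pos coarse.N_pos by (simp add: field_simps)
  have eq2: "seg fine.F (i * k) (Suc i * k) - coarse.F i
      = (?e *\<^sub>R ?S - (1 / real N) *\<^sub>R th (Suc i)) + (seg fine.F (i * k) (Suc i * k) - mat 1 - ?e *\<^sub>R ?S)"
    by (simp add: layer_def)
  show ?thesis unfolding eq2 by (rule order.trans[OF spec_norm_add_le add_mono[OF 2 1]])
qed

text \<open>Replacing one block at a time costs a multiple of
  \<open>(D + 1 / real N) / real N\<close> per block. The power in front absorbs the amplification
  by later layers, so the block errors simply add.\<close>

lemma spec_norm_seg_refine_power:
  "i \<le> j \<Longrightarrow> j \<le> N \<Longrightarrow> spec_norm (seg fine.F (i * k) (j * k) - seg coarse.F i j)
    \<le> (1 + 1 / (2 * real N)) ^ (j - i) * (2 * real (j - i) / real N * (D + 1 / real N))"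
proof (induction j rule: dec_induct)
  case base
  show ?case by simp
next
  case (step j)
  let ?p = "1 + 1 / (2 * real N)" and ?d = "D + 1 / real N"
  let ?Q = "seg fine.F (j * k) (Suc j * k)" and ?s = "seg fine.F (i * k) (j * k)"
  have le: "j * k \<le> N * k" using step by (intro mult_right_mono) auto
  have comp: "seg fine.F (i * k) (Suc j * k) = ?Q ** ?s"
    using step by (intro seg_compose[symmetric]) auto
  have eq: "seg fine.F (i * k) (Suc j * k) - seg coarse.F i (Suc j)
      = (?Q - coarse.F j) ** ?s + coarse.F j ** (?s - seg coarse.F i j)"
    unfolding comp using step by (simp add: seg_Suc mm.diff_left mm.diff_right)
  have "spec_norm ((?Q - coarse.F j) ** ?s) \<le> (D / real N + 1 / (real N)\<^sup>2) * 2"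
    using step le D_nonneg
    by (intro order.trans[OF spec_norm_mult_le] mult_mono spec_norm_block_diff fine.spec_norm_seg) auto
  also have "\<dots> = 2 / real N * ?d"
    by (simp add: add_divide_distrib distrib_left power2_eq_square)
  also have "\<dots> \<le> ?p ^ (Suc j - i) * (2 / real N * ?d)"
  proof -
    have "1 \<le> ?p ^ (Suc j - i)" by (rule one_le_power) simp
    then show ?thesis using D_nonneg mult_right_mono[of 1 "?p ^ (Suc j - i)" "2 / real N * ?d"] by simp
  qed
  finally have 1: "spec_norm ((?Q - coarse.F j) ** ?s) \<le> ?p ^ (Suc j - i) * (2 / real N * ?d)" .
  have "spec_norm (coarse.F j ** (?s - seg coarse.F i j))
      \<le> ?p * (?p ^ (j - i) * (2 * real (j - i) / real N * ?d))"
    using step by (intro order.trans[OF spec_norm_mult_le] mult_mono coarse.spec_norm_layer step.IH) auto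
  also have "\<dots> = ?p ^ (Suc j - i) * (2 * real (j - i) / real N * ?d)"
    using step by (simp add: Suc_diff_le)
  finally have "spec_norm (seg fine.F (i * k) (Suc j * k) - seg coarse.F i (Suc j))
      \<le> ?p ^ (Suc j - i) * (2 / real N * ?d) + ?p ^ (Suc j - i) * (2 * real (j - i) / real N * ?d)"
    unfolding eq using 1 by (intro order.trans[OF spec_norm_add_le] add_mono)
  also have "\<dots> = ?p ^ (Suc j - i) * (2 * real (Suc j - i) / real N * ?d)"
  proof -
    have "real (Suc j - i) = 1 + real (j - i)" using step by (simp add: Suc_diff_le)
    then show ?thesis by (simp only: distrib_left distrib_right add_divide_distrib mult_1_right)
  qed
  finally show ?case .
qed

lemma spec_norm_seg_refine:
  assumes "i \<le> j" "j \<le> N"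
  shows "spec_norm (seg fine.F (i * k) (j * k) - seg coarse.F i j) \<le> 4 * (D + 1 / real N)"
proof -
  have "spec_norm (seg fine.F (i * k) (j * k) - seg coarse.F i j)
    \<le> (1 + 1 / (2 * real N)) ^ (j - i) * (2 * real (j - i) / real N * (D + 1 / real N))"
    by (rule spec_norm_seg_refine_power) fact+
  also have "\<dots> \<le> 2 * (2 * (D + 1 / real N))"
  proof (intro mult_mono)
    show "(1 + 1 / (2 * real N)) ^ (j - i) \<le> 2"
      using coarse.power_le_exp_half[of "j - i"] exp_half_le_2 assms by linarith
    have "real (j - i) \<le> real N" using assms by simp
    then show "2 * real (j - i) / real N \<le> 2" using coarse.N_pos by (simp add: field_simps)
  qed (use D_nonneg in auto)
  finally show ?thesis by simp
qed

lemma block_length_le: "n \<le> k \<Longrightarrow> 2 * (real n / real (N * k)) \<le> 2 / real N"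
proof -
  assume "n \<le> k"
  then have "real n / real k \<le> 1" using k_pos by simp
  then have "2 * (real n / real k) / real N \<le> 2 / real N" by (intro divide_right_mono) auto
  then show ?thesis by (simp add: mult.commute)
qed

lemma div_less: "j < N * k \<Longrightarrow> j div k < N"
  by (simp add: less_mult_imp_div_less)

text \<open>Rounding \<open>j\<close> down to a block boundary drops less than one block, costing at
  most 2/N; the remaining product is a whole number of blocks.\<close>

lemma spec_norm_prefix_refine:
  assumes j: "j \<le> N * k"
  shows "spec_norm (seg fine.F 0 j - seg coarse.F 0 (j div k)) \<le> 6 * (D + 1 / real N)"
proof -
  let ?n = "j div k"
  have n: "?n \<le> N" using div_le_mono[OF j, of k] k_pos by simp
  have nk: "?n * k \<le> j" "j - ?n * k < k" using k_pos by (simp_all add: modulo_nat_def[symmetric])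
  have "spec_norm (seg fine.F 0 j - seg fine.F 0 (?n * k)) \<le> 2 * (real (j - ?n * k) / real (N * k))"
    using nk j by (intro fine.spec_norm_seg_shift_right) auto
  also have "\<dots> \<le> 2 / real N"
    using nk by (intro block_length_le) simp
  finally have 1: "spec_norm (seg fine.F 0 j - seg fine.F 0 (?n * k)) \<le> 2 / real N" .
  have 2: "spec_norm (seg fine.F 0 (?n * k) - seg coarse.F 0 ?n) \<le> 4 * (D + 1 / real N)"
    using spec_norm_seg_refine[of 0 ?n] n by simp
  from spec_norm_diff_triangle[of "seg fine.F 0 j" "seg coarse.F 0 ?n" "seg fine.F 0 (?n * k)"] 1 2 D_nonneg
  show ?thesis by (simp add: algebra_simps)
qed

lemma spec_norm_inner_seg_refine:
  "j < N * k \<Longrightarrow> spec_norm (fine.inner_seg j - coarse.inner_seg (j div k)) \<le> 6 * (D + 1 / real N)"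
  unfolding fine.inner_seg_def coarse.inner_seg_def by (rule spec_norm_prefix_refine) simp

lemma spec_norm_outer_refine:
  assumes j: "j < N * k"
  shows "spec_norm (fine.outer j - coarse.outer (j div k)) \<le> 6 * (D + 1 / real N)"
proof -
  \<comment> \<open>The layers above \<open>j\<close> are rounded up, to the end of the block
    containing \<open>j\<close>, since the coarse product starts after the matching layer.\<close>
  let ?n = "j div k" and ?q = "Suc (j div k) * k"
  have n: "Suc ?n \<le> N" using div_less[OF j] by simp
  have q: "Suc j \<le> ?q" "?q - Suc j < k"
    using k_pos div_mult_mod_eq[of j k] mod_less_divisor[OF k_pos, of j]
    unfolding mult_Suc by linarith+
  have q': "?q \<le> N * k" using n by (rule mult_le_mono1)
  have "spec_norm (fine.outer j - seg fine.F ?q (N * k)) \<le> 2 * (real (?q - Suc j) / real (N * k))"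
    unfolding fine.outer_def using q q' by (intro fine.spec_norm_seg_shift_left) auto
  also have "\<dots> \<le> 2 / real N"
    using q(2) by (intro block_length_le) simp
  finally have 1: "spec_norm (fine.outer j - seg fine.F ?q (N * k)) \<le> 2 / real N" .
  have 2: "spec_norm (seg fine.F ?q (N * k) - coarse.outer ?n) \<le> 4 * (D + 1 / real N)"
    unfolding coarse.outer_def by (rule spec_norm_seg_refine) (use n in auto)
  from spec_norm_diff_triangle[of "fine.outer j" "coarse.outer ?n" "seg fine.F ?q (N * k)"] 1 2 D_nonneg
  show ?thesis by (simp add: algebra_simps)
qed

end

section \<open>Gradient flow at fixed depth\<close>

lemma norm_increment_le:
  fixes f :: "real \<Rightarrow> 'a::real_normed_vector"
  assumes "0 \<le> a" "a \<le> b"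
    and f: "\<And>t. a \<le> t \<Longrightarrow> t \<le> b \<Longrightarrow> (f has_vector_derivative f' t) (at t within {0..})"
    and phi: "\<And>t. a \<le> t \<Longrightarrow> t \<le> b \<Longrightarrow> (phi has_real_derivative phi' t) (at t within {0..})"
    and le: "\<And>t. a \<le> t \<Longrightarrow> t \<le> b \<Longrightarrow> norm (f' t) \<le> phi' t"
  shows "norm (f b - f a) \<le> phi b - phi a"
proof (cases "a = b")
  case False
  have sub: "{a..b} \<subseteq> {0..}" using assms(1) by auto
  have at: "at t within {0..} = at t" if "a < t" for t
    using that assms(1) by (intro at_within_interior) simp
  show ?thesis
  proof (rule differentiable_bound_general)
    show "a < b" using False assms(2) by simp
    show "continuous_on {a..b} f"
    proof (rule continuous_on_vector_derivative)
      fix t assume "t \<in> {a..b}"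
      then show "(f has_vector_derivative f' t) (at t within {a..b})"
        using f[of t] has_vector_derivative_within_subset[OF _ sub] by simp
    qed
    show "continuous_on {a..b} phi"
    proof (rule DERIV_continuous_on)
      fix t assume "t \<in> {a..b}"
      then show "(phi has_real_derivative phi' t) (at t within {a..b})"
        using phi[of t] DERIV_subset[OF _ sub] by simp
    qed
    show "(f has_vector_derivative f' t) (at t)" if "a < t" "t < b" for t
      using f[of t] that at[of t] by simp
    show "(phi has_vector_derivative phi' t) (at t)" if "a < t" "t < b" for t
      using phi[of t] that at[of t] by (simp add: has_real_derivative_iff_has_vector_derivative)
    show "norm (f' t) \<le> phi' t" if "a < t" "t < b" for t
      using le[of t] that by simp
  qed
qed simp

lemma nonpos_derivative_imp_le:
  fixes q :: "real \<Rightarrow> real"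
  assumes "0 \<le> t"
    and q: "\<And>s. 0 \<le> s \<Longrightarrow> s \<le> t \<Longrightarrow> (q has_real_derivative q' s) (at s within {0..})"
    and le: "\<And>s. 0 \<le> s \<Longrightarrow> s \<le> t \<Longrightarrow> q' s \<le> 0"
  shows "q t \<le> q 0"
proof (cases "t = 0")
  case False
  show ?thesis
  proof (rule DERIV_nonpos_imp_decreasing_open[of 0 t q])
    show "0 \<le> t" by fact
    show "\<exists>y. DERIV q s :> y \<and> y \<le> 0" if "0 < s" "s < t" for s
      using q[of s] le[of s] that at_within_interior[of s "{0..}"] by auto
    show "continuous_on {0..t} q"
    proof (rule DERIV_continuous_on)
      fix s assume "s \<in> {0..t}"
      then show "(q has_real_derivative q' s) (at s within {0..t})"
        using q[of s] DERIV_subset[of q _ s "{0..}" "{0..t}"] by simp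
    qed
  qed
qed simp

text \<open>Regularising by \<open>eta\<close> avoids differentiating the square root at zeros of \<open>q\<close>.\<close>

lemma sqrt_growth_le:
  fixes q :: "real \<Rightarrow> real"
  assumes "0 \<le> t" "0 < eta" "0 \<le> r"
    and q: "\<And>s. 0 \<le> s \<Longrightarrow> s \<le> t \<Longrightarrow> (q has_real_derivative q' s) (at s within {0..})"
    and nonneg: "\<And>s. 0 \<le> s \<Longrightarrow> s \<le> t \<Longrightarrow> 0 \<le> q s"
    and le: "\<And>s. 0 \<le> s \<Longrightarrow> s \<le> t \<Longrightarrow> q' s \<le> 2 * r * sqrt (q s)"
  shows "sqrt (q t) \<le> sqrt (q 0) + eta + r * t"
proof -
  let ?u = "\<lambda>s. sqrt (q s + eta\<^sup>2) - r * s"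
  have "?u t \<le> ?u 0"
  proof (rule nonpos_derivative_imp_le)
    fix s assume s: "0 \<le> s" "s \<le> t"
    have pos: "0 < q s + eta\<^sup>2" using nonneg[OF s] assms(2) by (simp add: add_nonneg_pos)
    show "(?u has_real_derivative (q' s / (2 * sqrt (q s + eta\<^sup>2)) - r)) (at s within {0..})"
      using pos by (auto intro!: derivative_eq_intros q[OF s] simp: field_simps)
    have "q' s \<le> 2 * r * sqrt (q s + eta\<^sup>2)"
      using le[OF s] mult_left_mono[of "sqrt (q s)" "sqrt (q s + eta\<^sup>2)" "2 * r"] assms(3) by simp
    then show "q' s / (2 * sqrt (q s + eta\<^sup>2)) - r \<le> 0"
      using pos by (simp add: field_simps)
  qed fact
  moreover have "sqrt (q t) \<le> sqrt (q t + eta\<^sup>2)" by simp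
  moreover have "sqrt (q 0 + eta\<^sup>2) \<le> sqrt (q 0) + eta"
    using sqrt_add_le_add_sqrt[of "q 0" "eta\<^sup>2"] nonneg[of 0] assms by simp
  ultimately show ?thesis by linarith
qed

text \<open>At the first time some \<open>f i\<close> reaches 0, left limits show that all functions
  are nonpositive up to and including that time, so \<open>step\<close> gives a contradiction.
  Finiteness of \<open>I\<close> makes the set of bad times closed and hence the first one
  attained.\<close>

lemma continuous_induction_strict:
  fixes f :: "'i \<Rightarrow> real \<Rightarrow> real"
  assumes fin: "finite I"
    and cont: "\<And>n. n \<in> I \<Longrightarrow> continuous_on {0..} (f n)"
    and init: "\<And>n. n \<in> I \<Longrightarrow> f n 0 \<le> 0"
    and step: "\<And>t n. 0 \<le> t \<Longrightarrow> (\<And>s i. 0 \<le> s \<Longrightarrow> s \<le> t \<Longrightarrow> i \<in> I \<Longrightarrow> f i s \<le> 0) \<Longrightarrow> n \<in> I \<Longrightarrow> f n t < 0"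
    and "0 \<le> t" "n \<in> I"
  shows "f n t < 0"
proof (rule ccontr)
  assume "\<not> f n t < 0"
  let ?A = "\<Union>i\<in>I. {s \<in> {0..}. 0 \<le> f i s}"
  have ne: "t \<in> ?A" using assms(5,6) \<open>\<not> f n t < 0\<close> by (auto simp: not_less)
  have cl: "closed ?A"
    by (intro closed_UN fin ballI continuous_on_closed_Collect_le cont continuous_on_const closed_atLeast)
  have bdd: "bdd_below ?A" by (auto intro!: bdd_belowI[of _ 0])
  define t0 where "t0 = Inf ?A"
  have t0: "t0 \<in> ?A" unfolding t0_def using closed_contains_Inf[OF _ bdd cl] ne by blast
  have before: "f i s < 0" if "0 \<le> s" "s < t0" "i \<in> I" for i s
    using that cInf_lower[OF _ bdd, of s] unfolding t0_def by force
  have le: "f i s \<le> 0" if "0 \<le> s" "s \<le> t0" "i \<in> I" for i s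
  proof (cases "s < t0")
    case True
    with before that show ?thesis by (simp add: less_imp_le)
  next
    case False
    then have s: "s = t0" using that by simp
    show ?thesis
    proof (cases "t0 = 0")
      case True
      with s init that show ?thesis by simp
    next
      case False
      then have pos: "0 < t0" using s that by simp
      have "isCont (f i) t0"
        using continuous_on_interior[OF cont[OF that(3)], of t0] pos by simp
      then have "(f i \<longlongrightarrow> f i t0) (at_left t0)"
        by (simp add: isCont_def filterlim_at_split)
      moreover have "\<forall>\<^sub>F s in at_left t0. f i s \<le> 0"
        using eventually_at_left_real[OF pos]
        by eventually_elim (use before that(3) in \<open>auto simp: less_imp_le\<close>)
      ultimately show ?thesis unfolding s by (rule tendsto_upperbound) simp
    qed
  qed
  from t0 obtain i where "i \<in> I" "0 \<le> t0" "0 \<le> f i t0" by auto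
  with step[of t0 i] le show False by force
qed

section \<open>Derivatives of the network and coercivity of the kernel operator\<close>

lemma transpose_diff: "transpose (U - V) = transpose U - transpose V"
  for U V :: "'d::finite mat"
  by (simp add: transpose_def vec_eq_iff)

text \<open>Telescoping with one factor exchanged at a time.\<close>

lemma norm_sandwich_diff_le:
  fixes A A' X X' C C' :: "'d::finite mat"
  shows "norm (A' ** X' ** C' - A ** X ** C)
    \<le> spec_norm (A' - A) * norm X' * spec_norm C' + spec_norm A * norm (X' - X) * spec_norm C'
      + spec_norm A * norm X * spec_norm (C' - C)"
proof -
  have "A' ** X' ** C' - A ** X ** C
      = (A' - A) ** X' ** C' + A ** (X' - X) ** C' + A ** X ** (C' - C)"
    by (simp add: mm.diff_left mm.diff_right)
  also have "norm \<dots> \<le> spec_norm (A' - A) * norm X' * spec_norm C' + spec_norm A * norm (X' - X) * spec_norm C'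
      + spec_norm A * norm X * spec_norm (C' - C)"
    by (intro norm_triangle_le add_mono norm_sandwich_le)
  finally show ?thesis .
qed

lemma norm_transpose_sandwich_diff_le:
  fixes A A' X X' C C' :: "'d::finite mat"
  shows "norm (transpose A' ** X' ** transpose C' - transpose A ** X ** transpose C)
    \<le> spec_norm (A' - A) * norm X' * spec_norm C' + spec_norm A * norm (X' - X) * spec_norm C'
      + spec_norm A * norm X * spec_norm (C' - C)"
  using norm_sandwich_diff_le[of "transpose A'" X' "transpose C'" "transpose A" X "transpose C"]
  by (simp add: transpose_diff[symmetric])

lemma inner_sandwich: "Y \<bullet> (A ** H ** C) = (transpose A ** Y ** transpose C) \<bullet> H"
  for A C H Y :: "'d::finite mat"
  using inner_mult_right[of "A ** H" C Y] inner_mult_left[of A H "Y ** transpose C"]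
  by (simp add: inner_commute matrix_mul_assoc)

lemma seg_cong: "(\<And>l. i \<le> l \<Longrightarrow> l < j \<Longrightarrow> f l = g l) \<Longrightarrow> seg f i j = seg g i j"
proof (induction j)
  case (Suc j)
  then show ?case by (cases "i \<le> j") (auto simp: seg_Suc)
qed simp

lemma PiN_split_layer:
  assumes "i < N"
  shows "PiN N th = seg (layer N th) (Suc i) N ** layer N th i ** seg (layer N th) 0 i"
  unfolding PiN_def resprod_eq_seg
  using assms seg_compose[of 0 i N "layer N th"] seg_Suc_left[of i N "layer N th"] by simp

text \<open>The network is affine in each single layer, with the products on either side as
  coefficients; this is the form in which the loss is differentiated.\<close>

lemma PiN_fun_upd:
  assumes "i < N"
  shows "PiN N (th(Suc i := X))
    = seg (layer N th) (Suc i) N ** (mat 1 + (1 / real N) *\<^sub>R X) ** seg (layer N th) 0 i"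
proof -
  have "seg (layer N (th(Suc i := X))) (Suc i) N = seg (layer N th) (Suc i) N"
    "seg (layer N (th(Suc i := X))) 0 i = seg (layer N th) 0 i"
    by (intro seg_cong; simp add: layer_def)+
  then show ?thesis using PiN_split_layer[OF assms, of "th(Suc i := X)"] by (simp add: layer_def)
qed

lemma has_vector_derivative_seg:
  fixes f :: "nat \<Rightarrow> real \<Rightarrow> 'd::finite mat"
  assumes "\<And>l. i \<le> l \<Longrightarrow> l < j \<Longrightarrow> (f l has_vector_derivative f' l) (at t within T)"
  shows "((\<lambda>u. seg (\<lambda>l. f l u) i j) has_vector_derivative
    (\<Sum>l=i..<j. seg (\<lambda>l. f l t) (Suc l) j ** f' l ** seg (\<lambda>l. f l t) i l)) (at t within T)"
  using assms
proof (induction j)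
  case (Suc j)
  show ?case
  proof (cases "i \<le> j")
    case True
    have "((\<lambda>u. f j u ** seg (\<lambda>l. f l u) i j) has_vector_derivative
        f j t ** (\<Sum>l=i..<j. seg (\<lambda>l. f l t) (Suc l) j ** f' l ** seg (\<lambda>l. f l t) i l)
        + f' j ** seg (\<lambda>l. f l t) i j) (at t within T)"
      by (intro mm.has_vector_derivative Suc.prems Suc.IH) (use True in auto)
    moreover have "f j t ** (\<Sum>l=i..<j. seg (\<lambda>l. f l t) (Suc l) j ** f' l ** seg (\<lambda>l. f l t) i l)
        = (\<Sum>l=i..<j. seg (\<lambda>l. f l t) (Suc l) (Suc j) ** f' l ** seg (\<lambda>l. f l t) i l)"
      unfolding mm.sum_right by (intro sum.cong) (auto simp: seg_Suc matrix_mul_assoc)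
    ultimately show ?thesis using True by (simp add: seg_Suc)
  qed simp
qed simp

locale layered = spd_bounds S m M + small_layers N th
  for S :: "'d::finite mat" and m M :: real and N :: nat and th :: "nat \<Rightarrow> 'd mat"
begin

text \<open>The neural tangent kernel as an operator on residuals: along the flow the residual has
  derivative \<open>-2\<close> times its image. Of the scale factors, the \<open>N\<close> in the
  flow cancels the 1/N in the partial gradient, leaving the 1/N of the layer derivative.\<close>

definition ntk :: "'d mat \<Rightarrow> 'd mat" where
  "ntk X = (1 / real N) *\<^sub>R (\<Sum>i<N. outer i ** backprop i (X ** S) ** inner_seg i)"

lemma inner_ntk: "(X ** S) \<bullet> ntk X = (1 / real N) * (\<Sum>i<N. (norm (backprop i (X ** S)))\<^sup>2)"
proof -
  have "(X ** S) \<bullet> (outer i ** backprop i (X ** S) ** inner_seg i) = (norm (backprop i (X ** S)))\<^sup>2" for i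
    unfolding power2_norm_eq_inner inner_sandwich by (simp add: backprop_def)
  then show ?thesis by (simp add: ntk_def inner_sum_right)
qed

text \<open>By adjointness the left factor paired with \<open>ntk X\<close> is an average of squared
  back-propagated norms, each at least \<open>exp (- 1)\<close> times that of \<open>X ** S\<close>.
  This is the Polyak-Lojasiewicz inequality.\<close>

lemma ntk_coercive: "exp (- 1) * m * ((X ** S) \<bullet> X) \<le> (X ** S) \<bullet> ntk X"
  for X :: "'d mat"
proof -
  have "exp (- 1) * m * ((X ** S) \<bullet> X) \<le> exp (- 1) * (norm (X ** S))\<^sup>2"
    using norm_mult_sigma_lower[of X] by (simp add: mult.assoc)
  also have "\<dots> = (1 / real N) * (\<Sum>i<N. exp (- 1) * (norm (X ** S))\<^sup>2)"
    using N_pos by simp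
  also have "\<dots> \<le> (1 / real N) * (\<Sum>i<N. (norm (backprop i (X ** S)))\<^sup>2)"
  proof (intro mult_left_mono sum_mono)
    fix i assume "i \<in> {..<N}"
    then have "(exp (- (1/2)) * norm (X ** S))\<^sup>2 \<le> (norm (backprop i (X ** S)))\<^sup>2"
      by (intro power_mono norm_backprop_lower) auto
    then show "exp (- 1) * (norm (X ** S))\<^sup>2 \<le> (norm (backprop i (X ** S)))\<^sup>2"
      by (simp add: power_mult_distrib exp_double[symmetric])
  qed simp
  finally show ?thesis by (simp add: inner_ntk)
qed

text \<open>Adjacent indices change each of the two side products by a single layer, which is within
  O(1/N) of the identity.\<close>

lemma norm_backprop_Suc_diff:
  assumes "Suc i < N"
  shows "norm (backprop (Suc i) X - backprop i X) \<le> 8 / real N * norm X"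
proof -
  have "norm (backprop (Suc i) X - backprop i X) \<le> spec_norm (outer (Suc i) - outer i) * norm X * spec_norm (inner_seg (Suc i))
      + spec_norm (outer i) * norm (X - X) * spec_norm (inner_seg (Suc i))
      + spec_norm (outer i) * norm X * spec_norm (inner_seg (Suc i) - inner_seg i)"
    unfolding backprop_def by (rule norm_transpose_sandwich_diff_le)
  also have "\<dots> \<le> 2 / real N * norm X * 2 + 2 * 0 * 2 + 2 * norm X * (2 / real N)"
    using assms
    by (intro add_mono mult_mono spec_norm_outer_Suc_diff spec_norm_inner_seg_Suc_diff spec_norm_outer
        spec_norm_inner_seg mult_nonneg_nonneg) auto
  finally show ?thesis by simp
qed

end

section \<open>Decay, bootstrap and regularity along one flow\<close>

context spd_bounds
begin

definition rate where "rate = 2 * m * exp (- 1)"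
text \<open>This is \<open>sqrt M\<close> times the threshold on the square root of the initial
  loss. The factor \<open>M\<close> cancels, so \<open>kappa\<close> bounds the initial norm of
  \<open>resid 0 ** S\<close>.\<close>

definition kappa where "kappa = m / (4 * sqrt (2 * exp 3))"

lemma rate_pos: "0 < rate"
  using m_pos by (simp add: rate_def)

lemma kappa_pos: "0 < kappa"
  using m_pos by (simp add: kappa_def)

end

locale gradient_flow = spd_bounds S m M
  for S :: "'d::finite mat" and m M :: real +
  fixes B :: "'d mat" and N :: nat and th :: "nat \<Rightarrow> real \<Rightarrow> 'd mat"
  assumes N1: "1 \<le> N"
    and flow: "grad_flow S B N th"
    and init_loss: "sqrt (lossN S B N (\<lambda>k. th k 0)) < m / (4 * sqrt (2 * M * exp 3))"
    and init_small: "n \<in> {1..N} \<Longrightarrow> spec_norm (th n 0) \<le> 1/4"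
begin

definition resid where "resid t = PiN N (\<lambda>k. th k t) - B"
abbreviation "back t \<equiv> small_layers.backprop N (\<lambda>k. th k t)"
abbreviation "small_at t \<equiv> layered S m M N (\<lambda>k. th k t)"
lemma small_atI: "(\<And>i. i < N \<Longrightarrow> spec_norm (th (Suc i) t) \<le> 1/2) \<Longrightarrow> small_at t"
  using N1 by (intro layered.intro small_layers.intro spd_bounds_axioms) auto

text \<open>\<open>grad_flow\<close> only asserts that some gradient exists; uniqueness of the
  derivative identifies it with the back-propagated residual. The factor \<open>N\<close> of the
  rescaled flow cancels the step size 1/N.\<close>

lemma param_derivative:
  assumes t: "0 \<le> t" and i: "i < N" and sm: "small_at t"
  shows "(th (Suc i) has_vector_derivative - 2 *\<^sub>R back t i (resid t ** S)) (at t within {0..})"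
proof -
  interpret layered S m M N "\<lambda>k. th k t" by fact
  let ?L = "\<lambda>X. lossN S B N ((\<lambda>k. th k t)(Suc i := X))"
  obtain G where G: "(?L has_derivative (\<lambda>H. G \<bullet> H)) (at (th (Suc i) t))"
    and th: "(th (Suc i) has_vector_derivative (- real N *\<^sub>R G)) (at t within {0..})"
    using flow t i unfolding grad_flow_def by fastforce
  let ?P = "\<lambda>X. outer i ** (mat 1 + (1 / real N) *\<^sub>R X) ** inner_seg i - B"
  have L: "?L = (\<lambda>X. (?P X ** S) \<bullet> ?P X)"
    by (simp add: lossN_def sq_sigma_norm_inner outer_def inner_seg_def PiN_fun_upd[OF i] fun_upd_def[symmetric])
  have P0: "?P (th (Suc i) t) = resid t"
    using PiN_split_layer[OF i, of "\<lambda>k. th k t"]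
    by (simp add: resid_def outer_def inner_seg_def layer_def[of _ _ i])
  let ?dP = "\<lambda>H. outer i ** ((1 / real N) *\<^sub>R H) ** inner_seg i"
  have dP: "(?P has_derivative ?dP) (at X)" for X
    by (auto intro!: derivative_eq_intros mm.FDERIV)
  have "(?L has_derivative (\<lambda>H. (resid t ** S) \<bullet> ?dP H + (?dP H ** S) \<bullet> resid t)) (at (th (Suc i) t))"
    unfolding L
    by (rule derivative_eq_intros bounded_linear.has_derivative[OF mm.bounded_linear_left] dP refl)+
      (simp only: P0)
  moreover have "(resid t ** S) \<bullet> ?dP H + (?dP H ** S) \<bullet> resid t = ((2 / real N) *\<^sub>R back t i (resid t ** S)) \<bullet> H" for H
  proof -
    have "(?dP H ** S) \<bullet> resid t = (resid t ** S) \<bullet> ?dP H" by (rule sigma_inner_commute)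
    moreover have "(resid t ** S) \<bullet> ?dP H = (1 / real N) * (back t i (resid t ** S) \<bullet> H)"
    proof -
      have "?dP H = (1 / real N) *\<^sub>R (outer i ** H ** inner_seg i)"
        by (simp add: mm.scaleR_left mm.scaleR_right)
      moreover have "(resid t ** S) \<bullet> (outer i ** H ** inner_seg i) = backprop i (resid t ** S) \<bullet> H"
        unfolding inner_sandwich by (simp add: backprop_def)
      ultimately show ?thesis by simp
    qed
    ultimately show ?thesis by simp
  qed
  ultimately have "(?L has_derivative (\<lambda>H. ((2 / real N) *\<^sub>R back t i (resid t ** S)) \<bullet> H)) (at (th (Suc i) t))"
    by simp
  from has_derivative_unique[OF G this] have "G = (2 / real N) *\<^sub>R back t i (resid t ** S)"
    by (metis vector_eq_ldot inner_commute)
  then show ?thesis using th N_pos by simp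
qed

lemma resid_derivative:
  assumes t: "0 \<le> t" and sm: "small_at t"
  shows "(resid has_vector_derivative - 2 *\<^sub>R layered.ntk S N (\<lambda>k. th k t) (resid t)) (at t within {0..})"
proof -
  interpret layered S m M N "\<lambda>k. th k t" by fact
  have "((\<lambda>u. layer N (\<lambda>k. th k u) l) has_vector_derivative (1 / real N) *\<^sub>R (- 2 *\<^sub>R back t l (resid t ** S)))
      (at t within {0..})" if "l < N" for l
    unfolding layer_def
    using has_vector_derivative_add[OF has_vector_derivative_const bounded_linear.has_vector_derivative[OF
        bounded_linear_scaleR_right[of "1 / real N"] param_derivative[OF t that sm]], of "mat 1"]
    by simp
  then have "((\<lambda>u. seg (\<lambda>l. layer N (\<lambda>k. th k u) l) 0 N) has_vector_derivative
      (\<Sum>l=0..<N. seg (\<lambda>l. layer N (\<lambda>k. th k t) l) (Suc l) N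
        ** ((1 / real N) *\<^sub>R (- 2 *\<^sub>R back t l (resid t ** S))) ** seg (\<lambda>l. layer N (\<lambda>k. th k t) l) 0 l)) (at t within {0..})"
    by (intro has_vector_derivative_seg) auto
  also have "(\<Sum>l=0..<N. seg (\<lambda>l. layer N (\<lambda>k. th k t) l) (Suc l) N
        ** ((1 / real N) *\<^sub>R (- 2 *\<^sub>R back t l (resid t ** S))) ** seg (\<lambda>l. layer N (\<lambda>k. th k t) l) 0 l)
      = - 2 *\<^sub>R ntk (resid t)"
    unfolding ntk_def scaleR_sum_right outer_def inner_seg_def atLeast0LessThan
    by (intro sum.cong) (simp_all add: mm.scaleR_left mm.scaleR_right mm.minus_left mm.minus_right)
  finally have "((\<lambda>u. seg (\<lambda>l. layer N (\<lambda>k. th k u) l) 0 N) has_vector_derivative - 2 *\<^sub>R ntk (resid t)) (at t within {0..})" .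
  then show ?thesis
    unfolding resid_def PiN_def resprod_eq_seg by (auto intro!: derivative_eq_intros)
qed

definition loss where "loss t = (resid t ** S) \<bullet> resid t"

lemma loss_derivative:
  assumes t: "0 \<le> t" and sm: "small_at t"
  shows "(loss has_real_derivative - 4 * ((resid t ** S) \<bullet> layered.ntk S N (\<lambda>k. th k t) (resid t))) (at t within {0..})"
proof -
  let ?K = "layered.ntk S N (\<lambda>k. th k t) (resid t)"
  have "(loss has_vector_derivative (resid t ** S) \<bullet> (- 2 *\<^sub>R ?K) + ((- 2 *\<^sub>R ?K) ** S) \<bullet> resid t) (at t within {0..})"
    unfolding loss_def
    by (intro bounded_bilinear.has_vector_derivative[OF bounded_bilinear_inner]
        bounded_linear.has_vector_derivative[OF mm.bounded_linear_left] resid_derivative t sm)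
  also have "((- 2 *\<^sub>R ?K) ** S) \<bullet> resid t = (resid t ** S) \<bullet> (- 2 *\<^sub>R ?K)"
    by (rule sigma_inner_commute)
  finally show ?thesis by (simp add: has_real_derivative_iff_has_vector_derivative)
qed

lemma loss_nonneg: "0 \<le> loss t"
  unfolding loss_def by (rule sigma_norm_nonneg)

text \<open>Coercivity makes the loss with its integrating factor nonincreasing. Smallness is
  required only up to time \<open>t\<close>, since the bootstrap invokes this estimate before
  smallness is known for all times.\<close>

lemma loss_decay:
  assumes "0 \<le> t" and sm: "\<And>s. 0 \<le> s \<Longrightarrow> s \<le> t \<Longrightarrow> small_at s"
  shows "loss t \<le> loss 0 * exp (- (2 * rate * t))"
proof -
  have "exp (2 * rate * t) * loss t \<le> exp (2 * rate * 0) * loss 0"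
  proof (rule nonpos_derivative_imp_le)
    fix s assume s: "0 \<le> s" "s \<le> t"
    interpret layered S m M N "\<lambda>k. th k s" by (rule sm[OF s])
    show "((\<lambda>s. exp (2 * rate * s) * loss s) has_real_derivative
        exp (2 * rate * s) * (2 * rate * loss s - 4 * ((resid s ** S) \<bullet> ntk (resid s)))) (at s within {0..})"
      by (rule derivative_eq_intros loss_derivative s(1) sm[OF s] refl)+ (simp add: algebra_simps)
    have "2 * rate * loss s \<le> 4 * ((resid s ** S) \<bullet> ntk (resid s))"
      using ntk_coercive[of "resid s"] by (simp add: loss_def rate_def algebra_simps)
    then show "exp (2 * rate * s) * (2 * rate * loss s - 4 * ((resid s ** S) \<bullet> ntk (resid s))) \<le> 0"
      by (simp add: mult_le_0_iff)
  qed fact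
  then show ?thesis by (simp add: exp_minus field_simps)
qed

lemma sqrt_M_loss_0: "sqrt (M * loss 0) \<le> kappa"
proof -
  have "sqrt (loss 0) \<le> m / (4 * sqrt (2 * M * exp 3))"
    using init_loss by (simp add: loss_def lossN_def sq_sigma_norm_inner resid_def)
  then have "sqrt M * sqrt (loss 0) \<le> sqrt M * (m / (4 * sqrt (2 * M * exp 3)))"
    using M_pos by (intro mult_left_mono) auto
  also have "\<dots> = kappa" using M_pos by (simp add: kappa_def real_sqrt_mult)
  finally show ?thesis by (simp add: real_sqrt_mult)
qed

lemma norm_resid_sigma_decay':
  assumes "0 \<le> t" and sm: "\<And>s. 0 \<le> s \<Longrightarrow> s \<le> t \<Longrightarrow> small_at s"
  shows "norm (resid t ** S) \<le> kappa * exp (- rate * t)"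
proof -
  have "(norm (resid t ** S))\<^sup>2 \<le> M * loss t"
    unfolding loss_def by (rule norm_mult_sigma_upper)
  also have "\<dots> \<le> M * (loss 0 * exp (- (2 * rate * t)))"
    using M_pos loss_decay[OF assms] by simp
  also have "\<dots> = (sqrt (M * loss 0) * exp (- rate * t))\<^sup>2"
    using M_pos loss_nonneg[of 0] by (simp add: power_mult_distrib exp_double[symmetric])
  finally have "norm (resid t ** S) \<le> sqrt (M * loss 0) * exp (- rate * t)"
    by (rule power2_le_imp_le) (use M_pos loss_nonneg[of 0] in auto)
  also have "\<dots> \<le> kappa * exp (- rate * t)"
    by (intro mult_right_mono sqrt_M_loss_0) simp
  finally show ?thesis .
qed

lemma continuous_on_params: "n \<in> {1..N} \<Longrightarrow> continuous_on {0..} (th n)"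
  using flow unfolding grad_flow_def continuous_on_eq_continuous_within
  by (metis has_vector_derivative_continuous atLeast_iff)

text \<open>The calibration of the initial loss: the powers of e in \<open>kappa\<close>, in
  \<open>rate\<close> and in the back-propagation bound cancel, and \<open>1 / (4 * sqrt 2)\<close>
  remains. Strictness is what the continuation principle needs.\<close>

lemma travel_le_quarter: "2 * exp (1/2) * kappa / rate < 1/4"
proof -
  have "sqrt (exp 3) = exp (3/2 :: real)"
    by (rule real_sqrt_unique) (simp_all add: exp_double[symmetric])
  then have "kappa = m / (4 * sqrt 2 * exp (3/2))" by (simp add: kappa_def real_sqrt_mult)
  moreover have "exp (3/2) = exp (1/2) * exp (1::real)" by (simp add: exp_add[symmetric])
  ultimately have "2 * exp (1/2) * kappa / rate = 1 / (4 * sqrt 2)"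
    using m_pos by (simp add: rate_def exp_minus field_simps)
  also have "\<dots> < 1/4" by (simp add: field_simps)
  finally show ?thesis .
qed

lemma exp_decay_derivative:
  "((\<lambda>t. - (b / rate) * exp (- rate * t)) has_real_derivative b * exp (- rate * t)) (at t within T)"
  using rate_pos by (auto intro!: derivative_eq_intros)

lemma exp_decay_increment:
  assumes "0 \<le> b" "0 \<le> t"
  shows "- (b / rate) * exp (- rate * t) - (- (b / rate) * exp (- rate * 0)) \<le> b / rate"
  using assms rate_pos by simp

text \<open>The bootstrap: while the bound 1/2 holds, the speed of each parameter decays
  exponentially and its total displacement is below 1/4. Together with the initial 1/4 this improves
  1/2 to a strict inequality.\<close>

lemma small_always:
  assumes "0 \<le> t"
  shows "small_at t"
proof (rule small_atI)
  fix i assume i: "i < N"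
  have "spec_norm (th (Suc i) t) - 1/2 < 0"
  proof (rule continuous_induction_strict[where I = "{..<N}" and f = "\<lambda>i t. spec_norm (th (Suc i) t) - 1/2"])
    fix i assume i: "i \<in> {..<N}"
    have "continuous_on UNIV (spec_norm :: 'd mat \<Rightarrow> real)"
    proof (rule continuous_on_subset[OF lipschitz_on_continuous_on])
      show "1-lipschitz_on UNIV (spec_norm :: 'd mat \<Rightarrow> real)"
      proof (rule lipschitz_onI)
        fix X Y :: "'d mat"
        show "dist (spec_norm X) (spec_norm Y) \<le> 1 * dist X Y"
          using spec_norm_add_le[of "X - Y" Y] spec_norm_add_le[of "Y - X" X]
            spec_norm_le_norm[of "X - Y"] spec_norm_le_norm[of "Y - X"]
          by (simp add: dist_norm norm_minus_commute abs_le_iff)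
      qed simp
    qed simp
    then have "continuous_on {0..} (spec_norm \<circ> th (Suc i))"
      using i by (intro continuous_on_compose continuous_on_params) (auto intro: continuous_on_subset)
    then show "continuous_on {0..} (\<lambda>t. spec_norm (th (Suc i) t) - 1/2)"
      by (intro continuous_intros) (simp add: comp_def)
    show "spec_norm (th (Suc i) 0) - 1/2 \<le> 0"
      using init_small[of "Suc i"] i by simp
  next
    fix t i
    assume t: "0 \<le> t" and i: "i \<in> {..<N}"
      and le: "\<And>s i. 0 \<le> s \<Longrightarrow> s \<le> t \<Longrightarrow> i \<in> {..<N} \<Longrightarrow> spec_norm (th (Suc i) s) - 1/2 \<le> 0"
    have sm: "small_at s" if "0 \<le> s" "s \<le> t" for s
      by (rule small_atI) (use le[OF that] in simp)
    \<comment> \<open>The 2 comes from the gradient, \<open>exp (1/2)\<close> from back-propagation,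
      and \<open>kappa\<close> from the initial residual.\<close>
    let ?b = "2 * exp (1/2) * kappa"
    have "norm (th (Suc i) t - th (Suc i) 0)
        \<le> - (?b / rate) * exp (- rate * t) - (- (?b / rate) * exp (- rate * 0))"
    proof (rule norm_increment_le)
      fix s assume s: "0 \<le> s" "s \<le> t"
      interpret layered S m M N "\<lambda>k. th k s" by (rule sm[OF s])
      show "(th (Suc i) has_vector_derivative - 2 *\<^sub>R back s i (resid s ** S)) (at s within {0..})"
        using s i by (intro param_derivative sm) auto
      show "((\<lambda>t. - (?b / rate) * exp (- rate * t)) has_real_derivative ?b * exp (- rate * s)) (at s within {0..})"
        by (rule exp_decay_derivative)
      have "norm (back s i (resid s ** S)) \<le> exp (1/2) * norm (resid s ** S)"
        using i by (intro norm_backprop_upper) auto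
      also have "\<dots> \<le> exp (1/2) * (kappa * exp (- rate * s))"
        using s by (intro mult_left_mono norm_resid_sigma_decay' sm) auto
      finally show "norm (- 2 *\<^sub>R back s i (resid s ** S)) \<le> ?b * exp (- rate * s)"
        by simp
    qed (use t in auto)
    also have "\<dots> \<le> ?b / rate"
      using kappa_pos t by (intro exp_decay_increment) auto
    also have "\<dots> < 1/4" by (rule travel_le_quarter)
    finally have "spec_norm (th (Suc i) t - th (Suc i) 0) < 1/4"
      using spec_norm_le_norm order_le_less_trans by blast
    then show "spec_norm (th (Suc i) t) - 1/2 < 0"
      using spec_norm_add_le[of "th (Suc i) t - th (Suc i) 0" "th (Suc i) 0"] init_small[of "Suc i"] i
      by simp
  qed (use assms i in auto)
  then show "spec_norm (th (Suc i) t) \<le> 1/2" by simp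
qed

lemma norm_resid_sigma_decay: "0 \<le> t \<Longrightarrow> norm (resid t ** S) \<le> kappa * exp (- rate * t)"
  by (intro norm_resid_sigma_decay' small_always)

lemma norm_resid_decay: "0 \<le> t \<Longrightarrow> norm (resid t) \<le> kappa / m * exp (- rate * t)"
  using order.trans[OF norm_mult_sigma_ge norm_resid_sigma_decay[of t]] m_pos
  by (simp add: field_simps)

text \<open>Neighbouring parameters follow velocities that differ by O(1/N) times the decaying
  residual; integrating over all times gives \<open>16 * kappa / rate\<close>.\<close>

lemma param_smooth:
  assumes t: "0 \<le> t" and i: "Suc i < N"
    and init: "norm (th (Suc (Suc i)) 0 - th (Suc i) 0) \<le> b / real N"
  shows "norm (th (Suc (Suc i)) t - th (Suc i) t) \<le> (b + 16 * kappa / rate) / real N"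
proof -
  let ?d = "\<lambda>t. th (Suc (Suc i)) t - th (Suc i) t"
  let ?b = "16 * kappa / real N"
  have "norm (?d t - ?d 0) \<le> - (?b / rate) * exp (- rate * t) - (- (?b / rate) * exp (- rate * 0))"
  proof (rule norm_increment_le)
    fix s assume s: "0 \<le> s" "s \<le> t"
    interpret layered S m M N "\<lambda>k. th k s" by (rule small_always[OF s(1)])
    show "(?d has_vector_derivative (- 2 *\<^sub>R back s (Suc i) (resid s ** S) - - 2 *\<^sub>R back s i (resid s ** S))) (at s within {0..})"
      using s i by (intro derivative_intros param_derivative small_always) auto
    show "((\<lambda>t. - (?b / rate) * exp (- rate * t)) has_real_derivative ?b * exp (- rate * s)) (at s within {0..})"
      by (rule exp_decay_derivative)
    have "norm (- 2 *\<^sub>R back s (Suc i) (resid s ** S) - - 2 *\<^sub>R back s i (resid s ** S))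
        = 2 * norm (back s (Suc i) (resid s ** S) - back s i (resid s ** S))"
    proof -
      have "- 2 *\<^sub>R U - - 2 *\<^sub>R V = - 2 *\<^sub>R (U - V)" for U V :: "'d mat" by (simp only: scaleR_diff_right)
      then show ?thesis by simp
    qed
    also have "\<dots> \<le> 2 * (8 / real N * (kappa * exp (- rate * s)))"
      using i s by (intro mult_left_mono order.trans[OF norm_backprop_Suc_diff] norm_resid_sigma_decay) auto
    finally show "norm (- 2 *\<^sub>R back s (Suc i) (resid s ** S) - - 2 *\<^sub>R back s i (resid s ** S)) \<le> ?b * exp (- rate * s)"
      by simp
  qed (use t in auto)
  also have "\<dots> \<le> ?b / rate"
    using kappa_pos t by (intro exp_decay_increment) auto
  finally have "norm (?d t) \<le> ?b / rate + b / real N"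
    using init norm_triangle_ineq[of "?d t - ?d 0" "?d 0"] by simp
  then show ?thesis by (simp add: add_divide_distrib mult.commute)
qed

lemma param_Lipschitz_time:
  assumes "0 \<le> t" "0 \<le> t'" and i: "i < N"
  shows "norm (th (Suc i) t - th (Suc i) t') \<le> 4 * kappa * \<bar>t - t'\<bar>"
proof -
  have *: "norm (th (Suc i) t - th (Suc i) t') \<le> 4 * kappa * t - 4 * kappa * t'" if "0 \<le> t'" "t' \<le> t" for t t'
  proof (rule norm_increment_le)
    fix s assume "t' \<le> s" "s \<le> t"
    then have s: "0 \<le> s" using that by simp
    interpret layered S m M N "\<lambda>k. th k s" by (rule small_always[OF s])
    show "(th (Suc i) has_vector_derivative - 2 *\<^sub>R back s i (resid s ** S)) (at s within {0..})"
      using s i by (intro param_derivative small_always) auto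
    show "((\<lambda>t. 4 * kappa * t) has_real_derivative 4 * kappa) (at s within {0..})"
      by (auto intro!: derivative_eq_intros)
    have "norm (back s i (resid s ** S)) \<le> exp (1/2) * (kappa * exp (- rate * s))"
      using i s by (intro order.trans[OF norm_backprop_upper] mult_left_mono norm_resid_sigma_decay) auto
    also have "\<dots> \<le> 2 * (kappa * 1)"
      using kappa_pos rate_pos s exp_half_le_2 by (intro mult_mono) auto
    finally show "norm (- 2 *\<^sub>R back s i (resid s ** S)) \<le> 4 * kappa" by simp
  qed (use that in auto)
  show ?thesis
  proof (cases "t' \<le> t")
    case True
    then show ?thesis using *[of t' t] assms by (simp add: algebra_simps)
  next
    case False
    then show ?thesis using *[of t t'] assms by (simp add: norm_minus_commute algebra_simps)
  qed
qed

end

section \<open>Comparing depths N and Nk\<close>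

lemma sum_div_block:
  fixes f :: "nat \<Rightarrow> 'a::real_vector"
  assumes "0 < k"
  shows "(\<Sum>j<N * k. f (j div k)) = real k *\<^sub>R (\<Sum>n<N. f n)"
proof -
  have "(\<Sum>j<N * k. f (j div k)) = (\<Sum>n<N. \<Sum>j=n*k..<n*k+k. f (j div k))"
    by (rule sum.nat_group[symmetric])
  also have "\<dots> = (\<Sum>n<N. \<Sum>j=n*k..<n*k+k. f n)"
  proof (intro sum.cong refl)
    fix n j assume "j \<in> {n*k..<n*k+k}"
    then have "j div k = n" by (intro div_nat_eqI) (auto simp: mult.commute)
    then show "f (j div k) = f n" by simp
  qed
  finally show ?thesis by (simp add: sum_constant_scaleR scaleR_sum_right del: sum_constant)
qed

lemma (in layered) ntk_diff: "ntk (X - Y) = ntk X - ntk Y"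
  by (simp add: ntk_def backprop_def mm.diff_left mm.diff_right sum_subtractf scaleR_diff_right)

locale refined_layered =
  coarse: layered S m M N th + fine: layered S m M "N * k" th' + refined_layers N k th th' D
  for S :: "'d::finite mat" and m M :: real and N k :: nat and th th' :: "nat \<Rightarrow> 'd mat" and D :: real
begin

abbreviation "d \<equiv> D + 1 / real N"

lemma d_nonneg: "0 \<le> d"
  using D_nonneg by simp

lemma norm_backprop_refine:
  assumes j: "j < N * k"
  shows "norm (fine.backprop j X' - coarse.backprop (j div k) X)
    \<le> 12 * d * (norm X' + norm X) + 4 * norm (X' - X)"
proof -
  have "norm (fine.backprop j X' - coarse.backprop (j div k) X) \<le>
      spec_norm (fine.outer j - coarse.outer (j div k)) * norm X' * spec_norm (fine.inner_seg j)
      + spec_norm (coarse.outer (j div k)) * norm (X' - X) * spec_norm (fine.inner_seg j)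
      + spec_norm (coarse.outer (j div k)) * norm X * spec_norm (fine.inner_seg j - coarse.inner_seg (j div k))"
    unfolding fine.backprop_def coarse.backprop_def by (rule norm_transpose_sandwich_diff_le)
  also have "\<dots> \<le> (6 * d) * norm X' * 2 + 2 * norm (X' - X) * 2 + 2 * norm X * (6 * d)"
    using j div_less[OF j] d_nonneg
    by (intro add_mono mult_mono spec_norm_outer_refine spec_norm_inner_seg_refine fine.spec_norm_inner_seg
        coarse.spec_norm_outer order.refl mult_nonneg_nonneg) auto
  finally show ?thesis by (simp add: algebra_simps add_divide_distrib)
qed

text \<open>Rewriting the coarse average as an average over fine indices pairs the summands one to
  one. The constant 144 is 24 + 96 + 24, from the left factor, the back-propagated middle and the
  right factor.\<close>

lemma norm_ntk_refine: "norm (fine.ntk X - coarse.ntk X) \<le> 144 * M * d * norm X"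
proof -
  let ?Y = "X ** S"
  let ?f = "\<lambda>j. fine.outer j ** fine.backprop j ?Y ** fine.inner_seg j"
  let ?c = "\<lambda>n. coarse.outer n ** coarse.backprop n ?Y ** coarse.inner_seg n"
  have up: "norm (fine.backprop j ?Y) \<le> 2 * norm ?Y" if "j < N * k" for j
    using fine.norm_backprop_upper[OF that, of ?Y] mult_right_mono[OF exp_half_le_2, of "norm ?Y"] by simp
  have up': "norm (coarse.backprop n ?Y) \<le> 2 * norm ?Y" if "n < N" for n
    using coarse.norm_backprop_upper[OF that, of ?Y] mult_right_mono[OF exp_half_le_2, of "norm ?Y"] by simp
  have summand: "norm (?f j - ?c (j div k)) \<le> 144 * d * norm ?Y" if j: "j < N * k" for j
  proof -
    have "norm (fine.backprop j ?Y - coarse.backprop (j div k) ?Y) \<le> 24 * d * norm ?Y"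
      using norm_backprop_refine[OF j, of ?Y ?Y] by (simp add: algebra_simps add_divide_distrib)
    then have "norm (?f j - ?c (j div k)) \<le> (6 * d) * (2 * norm ?Y) * 2 + 2 * (24 * d * norm ?Y) * 2
        + 2 * (2 * norm ?Y) * (6 * d)"
      using j div_less[OF j] d_nonneg
      by (intro order.trans[OF norm_sandwich_diff_le] add_mono mult_mono spec_norm_outer_refine
          spec_norm_inner_seg_refine fine.spec_norm_inner_seg coarse.spec_norm_outer up up'
          mult_nonneg_nonneg) auto
    then show ?thesis by (simp add: algebra_simps add_divide_distrib)
  qed
  have "coarse.ntk X = (1 / real (N * k)) *\<^sub>R (\<Sum>j<N * k. ?c (j div k))"
    using k_pos by (subst sum_div_block) (simp_all add: coarse.ntk_def)
  then have "fine.ntk X - coarse.ntk X = (1 / real (N * k)) *\<^sub>R (\<Sum>j<N * k. ?f j - ?c (j div k))"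
    by (simp add: fine.ntk_def sum_subtractf scaleR_diff_right)
  then have "norm (fine.ntk X - coarse.ntk X) \<le> (1 / real (N * k)) * (\<Sum>j<N * k. 144 * d * norm ?Y)"
    using sum_norm_le[of "{..<N * k}" "\<lambda>j. ?f j - ?c (j div k)" "\<lambda>_. 144 * d * norm ?Y"] summand
    by (simp add: divide_right_mono del: sum_constant)
  also have "\<dots> = 144 * d * norm ?Y" using coarse.N_pos k_pos by simp
  also have "\<dots> \<le> 144 * d * (M * norm X)"
    using d_nonneg by (intro mult_left_mono coarse.norm_mult_sigma_le) auto
  finally show ?thesis by (simp add: mult_ac)
qed

end

context spd_bounds
begin

text \<open>The slope bounds the growth of the exponentially weighted residual gap per unit of depth
  error. \<open>resid_gap_const\<close> collects the initial gap, the regularisation and this slope,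
  and \<open>sqrt m\<close> returns to the Frobenius norm. In \<open>param_gap_const\<close>, 48
  comes from differing products and 8 from differing residuals.\<close>

definition "resid_gap_slope = 288 * M * sqrt M * kappa / m"
definition "resid_gap_const = (4 * sqrt M * norm (mat 1 :: 'd mat) + 1 + resid_gap_slope) / sqrt m"
definition "param_gap_const = 48 * kappa + 8 * M * resid_gap_const"

lemma gap_constants_nonneg: "0 \<le> resid_gap_slope" "0 \<le> resid_gap_const" "0 \<le> param_gap_const"
  using m_pos M_pos kappa_pos
  by (auto simp: resid_gap_slope_def resid_gap_const_def param_gap_const_def intro!: add_nonneg_nonneg divide_nonneg_nonneg mult_nonneg_nonneg)

text \<open>The barrier solves \<open>\<phi>' = 2 K (1 + t) exp (- rate t) \<phi>\<close> with \<open>K = param_gap_const\<close>, and stays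
  bounded because \<open>(1 + t) exp (- rate t)\<close> is integrable.\<close>

definition "barrier_exponent t = - exp (- rate * t) * ((1 + t) / rate + 1 / rate\<^sup>2)"
definition "barrier t = exp (2 * param_gap_const * (barrier_exponent t - barrier_exponent 0))"
definition "barrier_bound = exp (2 * param_gap_const * (1 / rate + 1 / rate\<^sup>2))"

lemma barrier_exponent_derivative:
  "(barrier_exponent has_real_derivative (1 + t) * exp (- rate * t)) (at t within T)"
  unfolding barrier_exponent_def
  using rate_pos by (auto intro!: derivative_eq_intros simp: field_simps power2_eq_square)

lemma barrier_derivative:
  "(barrier has_real_derivative 2 * param_gap_const * (1 + t) * exp (- rate * t) * barrier t) (at t within T)"
  unfolding barrier_def
  by (auto intro!: derivative_eq_intros barrier_exponent_derivative)

lemma barrier_0 [simp]: "barrier 0 = 1"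
  by (simp add: barrier_def)

lemma barrier_mono: "0 \<le> s \<Longrightarrow> s \<le> t \<Longrightarrow> barrier s \<le> barrier t"
  by (rule DERIV_nonneg_imp_nondecreasing)
    (use gap_constants_nonneg in \<open>auto simp: barrier_def intro!: exI barrier_derivative[unfolded barrier_def]\<close>)

lemma barrier_le: "0 \<le> t \<Longrightarrow> barrier t \<le> barrier_bound"
proof -
  assume t: "0 \<le> t"
  have "0 \<le> exp (- rate * t) * ((1 + t) / rate + 1 / rate\<^sup>2)"
    using t rate_pos by simp
  then have "barrier_exponent t - barrier_exponent 0 \<le> 1 / rate + 1 / rate\<^sup>2"
    by (simp add: barrier_exponent_def)
  then show ?thesis unfolding barrier_def barrier_bound_def
    using gap_constants_nonneg by (simp add: mult_left_mono)
qed

end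

section \<open>Time-uniform comparison of the flows at depths N and Nk\<close>

locale flow_pair =
  coarse: gradient_flow S m M B N th + fine: gradient_flow S m M B "N * k" th'
  for S :: "'d::finite mat" and m M :: real and B :: "'d mat" and N k :: nat
    and th th' :: "nat \<Rightarrow> real \<Rightarrow> 'd mat" +
  fixes b :: real
  assumes b_nonneg: "0 \<le> b"
    and init_close: "j < N * k \<Longrightarrow> norm (th' (Suc j) 0 - th (Suc (j div k)) 0) \<le> b / real N"
begin

abbreviation "gap j t \<equiv> th' (Suc j) t - th (Suc (j div k)) t"
abbreviation "resid_gap t \<equiv> fine.resid t - coarse.resid t"

lemma N_pos: "0 < real N"
  using coarse.N1 by simp

lemma refined_at:
  assumes "0 \<le> t" and "\<And>j. j < N * k \<Longrightarrow> norm (gap j t) \<le> D"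
  shows "refined_layered S m M N k (\<lambda>n. th n t) (\<lambda>n. th' n t) D"
proof -
  interpret c: layered S m M N "\<lambda>n. th n t" by (rule coarse.small_always) fact
  interpret f: layered S m M "N * k" "\<lambda>n. th' n t" by (rule fine.small_always) fact
  show ?thesis
    by unfold_locales (use assms(2) spec_norm_le_norm order.trans in blast)
qed

lemma norm_resid_gap_init: "norm (resid_gap 0) \<le> 4 * (b / real N + 1 / real N) * norm (mat 1 :: 'd mat)"
proof -
  interpret refined_layered S m M N k "\<lambda>n. th n 0" "\<lambda>n. th' n 0" "b / real N"
    by (rule refined_at) (use init_close in auto)
  have "resid_gap 0 = seg (layer (N * k) (\<lambda>n. th' n 0)) (0 * k) (N * k) - seg (layer N (\<lambda>n. th n 0)) 0 N"
    by (simp add: fine.resid_def coarse.resid_def PiN_def resprod_eq_seg)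
  also have "norm \<dots> \<le> 4 * (b / real N + 1 / real N) * norm (mat 1 :: 'd mat)"
    by (intro order.trans[OF norm_le_spec_norm] mult_right_mono spec_norm_seg_refine) auto
  finally show ?thesis .
qed

text \<open>Contraction by the coarse kernel cancels the exponential weight, and the weighted source
  is bounded by a constant multiple of \<open>D + 1 / real N\<close>. The weighted gap thus grows at
  most linearly in time, which produces the factor \<open>1 + t\<close>.\<close>

lemma resid_gap_bound:
  assumes t: "0 \<le> t" and D: "b / real N \<le> D"
    and close: "\<And>s j. 0 \<le> s \<Longrightarrow> s \<le> t \<Longrightarrow> j < N * k \<Longrightarrow> norm (gap j s) \<le> D"
  shows "norm (resid_gap t) \<le> coarse.resid_gap_const * (D + 1 / real N) * (1 + t) * exp (- coarse.rate * t)"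
proof -
  let ?d = "D + 1 / real N" and ?rate = coarse.rate
  let ?E = "resid_gap"
  let ?sqn = "\<lambda>s. (?E s ** S) \<bullet> ?E s"
  let ?q = "\<lambda>s. exp (2 * ?rate * s) * ?sqn s"
  let ?r = "coarse.resid_gap_slope * ?d"
  let ?I = "norm (mat 1 :: 'd mat)"
  have d0: "0 \<le> ?d" "1 / real N \<le> ?d"
    using order.trans[OF divide_nonneg_nonneg D] b_nonneg by auto
  have sq: "sqrt (?q s) = exp (?rate * s) * sqrt (?sqn s)" for s
  proof -
    have eq: "exp (2 * ?rate * s) = (exp (?rate * s))\<^sup>2" by (simp add: exp_double[symmetric] mult.assoc)
    have "sqrt (exp (2 * ?rate * s)) = exp (?rate * s)" by (rule real_sqrt_unique) (simp_all only: eq exp_ge_zero)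
    then show ?thesis by (simp only: real_sqrt_mult)
  qed
  \<comment> \<open>The regularisation is taken as 1/N, the order of the error already
    present.\<close>
  have "sqrt (?q t) \<le> sqrt (?q 0) + 1 / real N + ?r * t"
  proof (rule sqrt_growth_le)
    fix s assume s: "0 \<le> s" "s \<le> t"
    interpret refined_layered S m M N k "\<lambda>n. th n s" "\<lambda>n. th' n s" D
      by (rule refined_at) (use s close in auto)
    let ?R = "fine.ntk (fine.resid s) - coarse.ntk (fine.resid s)"
    \<comment> \<open>Applying the coarse operator to both residuals makes the first term coercive;
      \<open>?R\<close> carries the defect between the operators.\<close>
    let ?dE = "- 2 *\<^sub>R coarse.ntk (?E s) - 2 *\<^sub>R ?R"
    have "(?E has_vector_derivative (- 2 *\<^sub>R fine.ntk (fine.resid s) - - 2 *\<^sub>R coarse.ntk (coarse.resid s))) (at s within {0..})"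
      by (intro has_vector_derivative_diff coarse.resid_derivative fine.resid_derivative
          coarse.small_always fine.small_always s)
    also have "- 2 *\<^sub>R fine.ntk (fine.resid s) - - 2 *\<^sub>R coarse.ntk (coarse.resid s) = ?dE"
      by (simp add: coarse.ntk_diff scaleR_diff_right)
    finally have dE: "(?E has_vector_derivative ?dE) (at s within {0..})" .
    have "(?sqn has_vector_derivative ((?E s ** S) \<bullet> ?dE + (?dE ** S) \<bullet> ?E s)) (at s within {0..})"
      by (intro bounded_bilinear.has_vector_derivative[OF bounded_bilinear_inner]
          bounded_linear.has_vector_derivative[OF mm.bounded_linear_left] dE)
    also have "(?dE ** S) \<bullet> ?E s = (?E s ** S) \<bullet> ?dE" by (rule coarse.sigma_inner_commute)
    finally have dq0: "(?sqn has_real_derivative 2 * ((?E s ** S) \<bullet> ?dE)) (at s within {0..})"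
      by (simp add: has_real_derivative_iff_has_vector_derivative)
    show "(?q has_real_derivative exp (2 * ?rate * s) * (2 * ?rate * ?sqn s + 2 * ((?E s ** S) \<bullet> ?dE))) (at s within {0..})"
      by (rule derivative_eq_intros dq0 refl)+ (simp add: algebra_simps)
    show "0 \<le> ?q s" by (simp add: coarse.sigma_norm_nonneg)
    have "?rate * ?sqn s \<le> 2 * ((?E s ** S) \<bullet> coarse.ntk (?E s))"
      using coarse.ntk_coercive[of "?E s"] by (simp add: coarse.rate_def algebra_simps)
    moreover have "(?E s ** S) \<bullet> ?dE = - 2 * ((?E s ** S) \<bullet> coarse.ntk (?E s)) - 2 * ((?E s ** S) \<bullet> ?R)"
      by (subst inner_diff_right) (simp only: inner_scaleR_right)
    ultimately have "2 * ?rate * ?sqn s + 2 * ((?E s ** S) \<bullet> ?dE) \<le> 4 * \<bar>(?E s ** S) \<bullet> ?R\<bar>"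
      using abs_ge_minus_self[of "(?E s ** S) \<bullet> ?R"] by linarith
    also have "\<dots> \<le> 4 * (norm (?E s ** S) * norm ?R)"
      by (intro mult_left_mono Cauchy_Schwarz_ineq2) simp
    also have "\<dots> \<le> 4 * ((sqrt M * sqrt (?sqn s)) * (144 * M * ?d * (coarse.kappa / m * exp (- ?rate * s))))"
    proof (intro mult_left_mono mult_mono)
      show "norm (?E s ** S) \<le> sqrt M * sqrt (?sqn s)"
        using coarse.norm_mult_sigma_upper[of "?E s"] by (simp add: real_sqrt_mult[symmetric] real_le_rsqrt)
      show "norm ?R \<le> 144 * M * ?d * (coarse.kappa / m * exp (- ?rate * s))"
        using d0 coarse.M_pos s
        by (intro order.trans[OF norm_ntk_refine] mult_left_mono fine.norm_resid_decay) auto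
    qed (use coarse.M_pos coarse.sigma_norm_nonneg in auto)
    also have "\<dots> = 2 * ?r * (exp (- ?rate * s) * sqrt (?sqn s))"
      by (simp add: coarse.resid_gap_slope_def)
    finally have "exp (2 * ?rate * s) * (2 * ?rate * ?sqn s + 2 * ((?E s ** S) \<bullet> ?dE))
        \<le> exp (2 * ?rate * s) * (2 * ?r * (exp (- ?rate * s) * sqrt (?sqn s)))"
      by (intro mult_left_mono) auto
    also have "\<dots> = 2 * ?r * ((exp (2 * ?rate * s) * exp (- ?rate * s)) * sqrt (?sqn s))" by simp
    also have "exp (2 * ?rate * s) * exp (- ?rate * s) = exp (?rate * s)" by (simp add: exp_add[symmetric])
    finally show "exp (2 * ?rate * s) * (2 * ?rate * ?sqn s + 2 * ((?E s ** S) \<bullet> ?dE)) \<le> 2 * ?r * sqrt (?q s)"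
      by (simp only: sq)
  qed (use t N_pos d0 coarse.gap_constants_nonneg in auto)
  also have "sqrt (?q 0) \<le> sqrt M * (4 * ?d * ?I)"
  proof -
    have "sqrt (?q 0) \<le> sqrt (M * (norm (?E 0))\<^sup>2)"
      using coarse.sigma_norm_upper[of "?E 0"] by simp
    also have "\<dots> = sqrt M * norm (?E 0)" by (simp add: real_sqrt_mult)
    also have "\<dots> \<le> sqrt M * (4 * (b / real N + 1 / real N) * ?I)"
      using coarse.M_pos by (intro mult_left_mono norm_resid_gap_init) auto
    also have "\<dots> \<le> sqrt M * (4 * ?d * ?I)"
      using coarse.M_pos D by (intro mult_left_mono mult_right_mono) auto
    finally show ?thesis .
  qed
  finally have "sqrt (?q t) \<le> sqrt M * (4 * ?d * ?I) + 1 / real N + ?r * t" by simp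
  also have "\<dots> \<le> sqrt M * (4 * ?d * ?I) * (1 + t) + ?d * (1 + t) + ?r * (1 + t)"
  proof (intro add_mono)
    have "0 \<le> sqrt M * (4 * ?d * ?I)" using coarse.M_pos d0 by simp
    then show "sqrt M * (4 * ?d * ?I) \<le> sqrt M * (4 * ?d * ?I) * (1 + t)"
      using t by (metis le_add_same_cancel1 mult.right_neutral mult_left_mono)
    show "1 / real N \<le> ?d * (1 + t)"
      using d0 t by (metis order.trans le_add_same_cancel1 mult.right_neutral mult_left_mono)
    show "?r * t \<le> ?r * (1 + t)"
      using d0 coarse.gap_constants_nonneg by (intro mult_left_mono) auto
  qed
  also have "\<dots> = (4 * sqrt M * ?I + 1 + coarse.resid_gap_slope) * ?d * (1 + t)"
  proof -
    have "a * (4 * x * y) * z + x * z + r * x * z = (4 * a * y + 1 + r) * x * z" for a x y z r :: real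
      by (simp add: algebra_simps)
    then show ?thesis .
  qed
  finally have "sqrt (?q t) \<le> (4 * sqrt M * ?I + 1 + coarse.resid_gap_slope) * ?d * (1 + t)" .
  then have "exp (?rate * t) * (sqrt m * norm (?E t)) \<le> (4 * sqrt M * ?I + 1 + coarse.resid_gap_slope) * ?d * (1 + t)"
  proof (rule order.trans[rotated])
    have "sqrt m * norm (?E t) = sqrt (m * (norm (?E t))\<^sup>2)" by (simp add: real_sqrt_mult)
    also have "\<dots> \<le> sqrt (?sqn t)" using coarse.sigma_norm_lower[of "?E t"] by simp
    finally show "exp (?rate * t) * (sqrt m * norm (?E t)) \<le> sqrt (?q t)" unfolding sq by simp
  qed
  then show ?thesis
    using coarse.m_pos unfolding coarse.resid_gap_const_def
    by (simp add: exp_minus field_simps)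
qed

text \<open>Gronwall by continuation: as long as all gaps stay below the barrier, their derivatives
  are bounded by its derivative. Starting from \<open>b + 1\<close> instead of \<open>b\<close>
  provides the strict margin.\<close>

lemma gap_less_barrier:
  assumes "0 \<le> t" "j < N * k"
  shows "norm (gap j t) - (b + 1) * coarse.barrier t / real N < 0"
proof (rule continuous_induction_strict[where I = "{..<N * k}"
      and f = "\<lambda>j t. norm (gap j t) - (b + 1) * coarse.barrier t / real N"])
  fix j assume j: "j \<in> {..<N * k}"
  then have n: "j div k < N" by (simp add: less_mult_imp_div_less)
  have "continuous_on {0..} coarse.barrier"
    by (rule DERIV_continuous_on[OF coarse.barrier_derivative])
  then show "continuous_on {0..} (\<lambda>t. norm (gap j t) - (b + 1) * coarse.barrier t / real N)"
    using n j by (intro continuous_intros coarse.continuous_on_params fine.continuous_on_params) (auto simp: N_pos)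
  show "norm (gap j 0) - (b + 1) * coarse.barrier 0 / real N \<le> 0"
    using init_close[of j] j N_pos by (simp add: field_simps)
next
  fix t j
  assume t: "0 \<le> t" and j: "j \<in> {..<N * k}"
    and le: "\<And>s j. 0 \<le> s \<Longrightarrow> s \<le> t \<Longrightarrow> j \<in> {..<N * k} \<Longrightarrow>
      norm (gap j s) - (b + 1) * coarse.barrier s / real N \<le> 0"
  from j have n: "j div k < N" by (simp add: less_mult_imp_div_less)
  let ?K = coarse.param_gap_const and ?rate = coarse.rate and ?phi = "\<lambda>s. (b + 1) / real N * coarse.barrier s"
  have "norm (gap j t - gap j 0) \<le> ?phi t - ?phi 0"
  proof (rule norm_increment_le)
    fix s assume s: "0 \<le> s" "s \<le> t"
    \<comment> \<open>Monotonicity of the barrier turns its value at \<open>s\<close> into a bound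
      for all gaps on the whole interval up to \<open>s\<close>, as the residual estimate
      requires.\<close>
    define D where "D = ?phi s"
    have gap_D: "norm (gap i u) \<le> D" if "0 \<le> u" "u \<le> s" "i < N * k" for u i
    proof -
      have "norm (gap i u) \<le> ?phi u" using le[of u i] that s by simp
      also have "\<dots> \<le> D" unfolding D_def
        using that b_nonneg by (intro mult_left_mono coarse.barrier_mono) auto
      finally show ?thesis .
    qed
    interpret refined_layered S m M N k "\<lambda>n. th n s" "\<lambda>n. th' n s" D
      by (rule refined_at) (use s gap_D in auto)
    have one: "1 \<le> coarse.barrier s" using coarse.barrier_mono[of 0 s] s by simp
    \<comment> \<open>The barrier starts at 1, so \<open>D\<close> dominates both the initial gap
      and the discretisation error; hence \<open>d\<close> is at most \<open>2 * D\<close>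
      below.\<close>
    have "(b + 1) / real N * 1 \<le> D"
      unfolding D_def using one b_nonneg by (intro mult_left_mono) auto
    then have D: "b / real N \<le> D" "1 / real N \<le> D"
      using b_nonneg N_pos by (auto simp: add_divide_distrib intro: order.trans[rotated])
    let ?X' = "fine.resid s ** S" and ?X = "coarse.resid s ** S"
    show "(gap j has_vector_derivative (- 2 *\<^sub>R fine.backprop j ?X' - - 2 *\<^sub>R coarse.backprop (j div k) ?X)) (at s within {0..})"
      using j n s
      by (intro has_vector_derivative_diff coarse.param_derivative fine.param_derivative
          coarse.small_always fine.small_always) auto
    show "(?phi has_real_derivative (b + 1) / real N * (2 * ?K * (1 + s) * exp (- ?rate * s) * coarse.barrier s)) (at s within {0..})"
      by (intro DERIV_cmult coarse.barrier_derivative)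
    let ?e = "exp (- ?rate * s)"
    have "- 2 *\<^sub>R fine.backprop j ?X' - - 2 *\<^sub>R coarse.backprop (j div k) ?X
        = - 2 *\<^sub>R (fine.backprop j ?X' - coarse.backprop (j div k) ?X)"
      by (simp only: scaleR_diff_right)
    then have "norm (- 2 *\<^sub>R fine.backprop j ?X' - - 2 *\<^sub>R coarse.backprop (j div k) ?X)
        = 2 * norm (fine.backprop j ?X' - coarse.backprop (j div k) ?X)" by simp
    also have "\<dots> \<le> 2 * (12 * d * (norm ?X' + norm ?X) + 4 * norm (?X' - ?X))"
      using j by (intro mult_left_mono norm_backprop_refine) auto
    also have "\<dots> \<le> 2 * (12 * d * (coarse.kappa * ?e + coarse.kappa * ?e) + 4 * (M * (coarse.resid_gap_const * d * (1 + s) * ?e)))"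
    proof (intro mult_left_mono add_mono)
      show "norm ?X' \<le> coarse.kappa * ?e" "norm ?X \<le> coarse.kappa * ?e"
        using s by (intro fine.norm_resid_sigma_decay coarse.norm_resid_sigma_decay; simp)+
      have "?X' - ?X = resid_gap s ** S" by (simp add: mm.diff_left)
      also have "norm \<dots> \<le> M * norm (resid_gap s)" by (rule coarse.norm_mult_sigma_le)
      also have "\<dots> \<le> M * (coarse.resid_gap_const * d * (1 + s) * ?e)"
        using coarse.M_pos s D gap_D by (intro mult_left_mono resid_gap_bound) auto
      finally show "norm (?X' - ?X) \<le> M * (coarse.resid_gap_const * d * (1 + s) * ?e)" .
    qed (use d_nonneg in auto)
    also have "\<dots> = d * ?e * (48 * coarse.kappa + 8 * M * coarse.resid_gap_const * (1 + s))"
      by (simp add: algebra_simps add_divide_distrib)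
    also have "\<dots> \<le> (2 * D) * ?e * (?K * (1 + s))"
    proof (intro mult_mono)
      show "48 * coarse.kappa + 8 * M * coarse.resid_gap_const * (1 + s) \<le> ?K * (1 + s)"
        unfolding coarse.param_gap_const_def distrib_right
        using s coarse.kappa_pos by (simp add: mult_le_cancel_left1)
    qed (use D d_nonneg coarse.kappa_pos coarse.M_pos coarse.gap_constants_nonneg s in auto)
    also have "\<dots> = (b + 1) / real N * (2 * ?K * (1 + s) * ?e * coarse.barrier s)"
      by (simp add: D_def)
    finally show "norm (- 2 *\<^sub>R fine.backprop j ?X' - - 2 *\<^sub>R coarse.backprop (j div k) ?X)
        \<le> (b + 1) / real N * (2 * ?K * (1 + s) * ?e * coarse.barrier s)" .
  qed (use t in auto)
  moreover have "norm (gap j 0) < ?phi 0"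
  proof -
    have "norm (gap j 0) \<le> b / real N" using init_close j by simp
    also have "\<dots> < ?phi 0" using N_pos by (simp add: divide_strict_right_mono)
    finally show ?thesis .
  qed
  ultimately have "norm (gap j t) < ?phi t"
    using norm_triangle_ineq[of "gap j t - gap j 0" "gap j 0"] by simp
  then show "norm (gap j t) - (b + 1) * coarse.barrier t / real N < 0" by simp
qed (use assms in auto)

lemma gap_le:
  assumes "0 \<le> t" "j < N * k"
  shows "norm (gap j t) \<le> (b + 1) * coarse.barrier_bound / real N"
proof -
  have "(b + 1) * coarse.barrier t / real N \<le> (b + 1) * coarse.barrier_bound / real N"
    using b_nonneg assms by (intro divide_right_mono mult_left_mono coarse.barrier_le) auto
  with gap_less_barrier[OF assms] show ?thesis by simp
qed

end

section \<open>The infinite-depth limit\<close>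

lemma limit_of_multiplicative_Cauchy:
  fixes u :: "nat \<Rightarrow> 'a::complete_space"
  assumes "1 \<le> N0" "0 \<le> K"
    and close: "\<And>N k. N0 \<le> N \<Longrightarrow> 1 \<le> k \<Longrightarrow> dist (u (N * k)) (u N) \<le> K / real N"
  obtains l where "u \<longlonglongrightarrow> l" "\<And>N. N0 \<le> N \<Longrightarrow> dist (u N) l \<le> K / real N"
proof -
  have pair: "dist (u M) (u N) \<le> K / real M + K / real N" if "N0 \<le> M" "N0 \<le> N" for M N
    using dist_triangle3[of "u M" "u N" "u (M * N)"] close[of M N] close[of N M] that assms(1)
    by (simp add: mult.commute)
  have lim0: "(\<lambda>N. K / real N) \<longlonglongrightarrow> 0"
    by (rule lim_const_over_n)
  have "Cauchy u"
  proof (rule metric_CauchyI)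
    fix e :: real assume "0 < e"
    then have "eventually (\<lambda>N. K / real N < e / 2) sequentially"
      using order_tendstoD(2)[OF lim0, of "e / 2"] by simp
    then obtain N1 where N1: "\<And>N. N1 \<le> N \<Longrightarrow> K / real N < e / 2"
      by (auto simp: eventually_sequentially)
    have "dist (u m) (u n) < e" if "max N0 N1 \<le> m" "max N0 N1 \<le> n" for m n
    proof -
      have "dist (u m) (u n) \<le> K / real m + K / real n" using pair that by simp
      also have "\<dots> < e / 2 + e / 2" using N1 that by (intro add_strict_mono) auto
      finally show ?thesis by simp
    qed
    then show "\<exists>M. \<forall>m\<ge>M. \<forall>n\<ge>M. dist (u m) (u n) < e" by blast
  qed
  then obtain l where l: "u \<longlonglongrightarrow> l"
    using Cauchy_convergent_iff convergent_def by blast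
  have "dist (u N) l \<le> K / real N" if "N0 \<le> N" for N
  proof (rule tendsto_le[OF sequentially_bot])
    \<comment> \<open>Letting the other depth tend to infinity removes its error, so the constant
      \<open>K\<close> survives unchanged.\<close>
    show "(\<lambda>M. K / real N + K / real M) \<longlonglongrightarrow> K / real N"
      using tendsto_add[OF tendsto_const lim0, of "K / real N"] by simp
    show "(\<lambda>M. dist (u N) (u M)) \<longlonglongrightarrow> dist (u N) l"
      by (intro tendsto_intros l)
    show "\<forall>\<^sub>F M in sequentially. dist (u N) (u M) \<le> K / real N + K / real M"
      using eventually_ge_at_top[of N0] by eventually_elim (use pair that in auto)
  qed
  with l that show ?thesis by blast
qed

lemma has_vector_derivative_quadratic_remainder:
  fixes f :: "real \<Rightarrow> 'a::real_normed_vector"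
  assumes "\<And>y. y \<in> T \<Longrightarrow> norm (f y - f x - (y - x) *\<^sub>R f') \<le> K * (y - x)\<^sup>2"
  shows "(f has_vector_derivative f') (at x within T)"
  unfolding has_vector_derivative_def has_derivative_within_alt
proof (intro conjI allI impI bounded_linear_scaleR_left)
  fix e :: real assume e: "0 < e"
  have "norm (f y - f x - (y - x) *\<^sub>R f') \<le> e * norm (y - x)"
    if "y \<in> T" "norm (y - x) < e / (\<bar>K\<bar> + 1)" for y
  proof -
    have "K * (y - x)\<^sup>2 \<le> (\<bar>K\<bar> + 1) * (norm (y - x) * norm (y - x))"
      by (simp add: power2_eq_square mult_right_mono flip: abs_mult)
    also have "\<dots> \<le> (\<bar>K\<bar> + 1) * (e / (\<bar>K\<bar> + 1) * norm (y - x))"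
      using that by (intro mult_left_mono mult_right_mono) auto
    also have "\<dots> = e * norm (y - x)" by (simp add: add_nonneg_eq_0_iff)
    finally show ?thesis using assms[OF that(1)] by linarith
  qed
  moreover have "0 < e / (\<bar>K\<bar> + 1)" using e by (simp add: add_nonneg_pos)
  ultimately show "\<exists>d>0. \<forall>y\<in>T. norm (y - x) < d \<longrightarrow> norm (f y - f x - (y - x) *\<^sub>R f') \<le> e * norm (y - x)"
    by blast
qed

text \<open>An energy estimate: the squared norm with integrating factor
  \<open>exp (- 2 * L * s)\<close> cannot increase.\<close>

lemma linear_ode_zero:
  fixes z :: "real \<Rightarrow> real^'d::finite" and A :: "real \<Rightarrow> 'd mat"
  assumes z: "\<And>s. s \<in> {0..1} \<Longrightarrow> (z has_vector_derivative A s *v z s) (at s within {0..1})"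
    and A: "\<And>s. s \<in> {0..1} \<Longrightarrow> norm (A s) \<le> L"
    and "z 0 = 0"
  shows "z 1 = 0"
proof -
  let ?q = "\<lambda>s. exp (- 2 * L * s) * (z s \<bullet> z s)"
  have dq: "(?q has_real_derivative exp (- 2 * L * s) * (2 * (z s \<bullet> (A s *v z s)) - 2 * L * (z s \<bullet> z s)))
      (at s within {0..1})" if "s \<in> {0..1}" for s
  proof -
    have "((\<lambda>s. z s \<bullet> z s) has_vector_derivative z s \<bullet> (A s *v z s) + (A s *v z s) \<bullet> z s) (at s within {0..1})"
      by (intro bounded_bilinear.has_vector_derivative[OF bounded_bilinear_inner] z that)
    then have "((\<lambda>s. z s \<bullet> z s) has_real_derivative 2 * (z s \<bullet> (A s *v z s))) (at s within {0..1})"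
      by (simp add: has_real_derivative_iff_has_vector_derivative inner_commute)
    note sqn = this
    show ?thesis
      by (rule derivative_eq_intros sqn refl)+ (simp add: algebra_simps)
  qed
  have "?q 1 \<le> ?q 0"
  proof (rule DERIV_nonpos_imp_decreasing_open[of 0 1 ?q])
    fix s :: real assume s: "0 < s" "s < 1"
    have "z s \<bullet> (A s *v z s) \<le> norm (z s) * (norm (A s) * norm (z s))"
      by (intro order.trans[OF norm_cauchy_schwarz] mult_left_mono order.trans[OF spec_norm_bound]
          mult_right_mono spec_norm_le_norm) auto
    also have "\<dots> \<le> norm (z s) * (L * norm (z s))"
      using s A[of s] by (intro mult_left_mono mult_right_mono) auto
    also have "\<dots> = L * (z s \<bullet> z s)" by (simp add: dot_square_norm power2_eq_square)
    finally have "exp (- 2 * L * s) * (2 * (z s \<bullet> (A s *v z s)) - 2 * L * (z s \<bullet> z s)) \<le> 0"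
      by (simp add: mult_le_0_iff)
    moreover have "at s within {0..1} = at s" using s by (intro at_within_interior) simp
    ultimately show "\<exists>y. (?q has_real_derivative y) (at s) \<and> y \<le> 0"
      using dq[of s] s by auto
  next
    show "continuous_on {0..1} ?q" by (rule DERIV_continuous_on[OF dq])
  qed simp
  then have "z 1 \<bullet> z 1 \<le> 0" using \<open>z 0 = 0\<close> by (simp add: mult_le_0_iff)
  then show ?thesis by (metis inner_gt_zero_iff not_le)
qed

section \<open>Correspondence between depth positions and layer indices\<close>

definition floor_idx :: "nat \<Rightarrow> real \<Rightarrow> nat" where
  "floor_idx N s = nat \<lfloor>real N * s\<rfloor>"

text \<open>Both conventions of \<open>psiN\<close> at index \<open>0\<close> are captured by truncated subtraction:
  the layer used at depth \<open>s\<close> has the zero-based number \<open>floor_idx N s - 1\<close>.\<close>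

lemma psiN_eq: "psiN N th s t = th (Suc (floor_idx N s - 1)) t"
  by (simp add: psiN_def floor_idx_def Let_def)

lemma floor_idx_bounds:
  assumes "0 \<le> s"
  shows "real (floor_idx N s) \<le> real N * s" "real N * s < real (floor_idx N s) + 1"
  using assms by (simp_all add: floor_idx_def of_nat_nat)

lemma floor_idx_le: "s \<le> 1 \<Longrightarrow> floor_idx N s \<le> N"
  unfolding floor_idx_def by (simp add: nat_le_iff floor_le_iff) (smt (verit) mult_left_le of_nat_0_le_iff)

lemma floor_idx_mono: "s \<le> s' \<Longrightarrow> floor_idx N s \<le> floor_idx N s'"
  unfolding floor_idx_def by (intro nat_mono floor_mono mult_left_mono) auto

text \<open>Nested floors make prefix lengths at depths \<open>N * k\<close> and \<open>N\<close>
  correspond exactly, so the comparison of prefixes needs no index correction.\<close>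

lemma floor_idx_div: "0 < k \<Longrightarrow> floor_idx (N * k) s div k = floor_idx N s"
proof -
  assume k: "0 < k"
  have "\<lfloor>real N * s\<rfloor> = \<lfloor>real (N * k) * s / real_of_int (int k)\<rfloor>" using k by simp
  also have "\<dots> = \<lfloor>real (N * k) * s\<rfloor> div int k" by (rule floor_divide_real_eq_div) simp
  finally show ?thesis
    unfolding floor_idx_def by (cases "0 \<le> \<lfloor>real (N * k) * s\<rfloor>") (simp_all add: nat_div_distrib' div_nonpos_pos_le0)
qed

lemma psi_idx_less: "1 \<le> N \<Longrightarrow> s \<le> 1 \<Longrightarrow> floor_idx N s - 1 < N"
  using floor_idx_le[of s N] by simp

text \<open>One unit is lost in the floor and one in the truncated subtraction.\<close>

lemma psi_idx_close: "0 \<le> s \<Longrightarrow> \<bar>real (floor_idx N s - 1) - real N * s\<bar> \<le> 2"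
  using floor_idx_bounds[of s N] by (cases "floor_idx N s = 0") (auto simp: of_nat_diff)

lemma norm_diff_le_steps:
  fixes f :: "nat \<Rightarrow> 'a::real_normed_vector"
  assumes step: "\<And>i. Suc i < N \<Longrightarrow> norm (f (Suc i) - f i) \<le> c" and "i < N" "i' < N"
  shows "norm (f i - f i') \<le> c * \<bar>real i - real i'\<bar>"
proof -
  have *: "norm (f j - f i) \<le> c * real (j - i)" if "i \<le> j" "j < N" for i j
    using that
  proof (induction j rule: dec_induct)
    case (step j)
    then have "norm (f (Suc j) - f i) \<le> c + c * real (j - i)"
      using assms(1)[of j] norm_triangle_ineq[of "f (Suc j) - f j" "f j - f i"] by simp
    also have "\<dots> = c * real (Suc j - i)"
      using step by (simp add: Suc_diff_le distrib_left)
    finally show ?case .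
  qed simp
  show ?thesis
  proof (cases "i' \<le> i")
    case True
    then show ?thesis using *[of i' i] assms by (simp add: of_nat_diff)
  next
    case False
    then show ?thesis using *[of i i'] assms by (simp add: norm_minus_commute of_nat_diff)
  qed
qed

lemma nat_div_real_bounds:
  assumes "0 < k"
  shows "real (j div k) \<le> real j / real k" "(real j + 1) / real k \<le> real (j div k) + 1"
proof -
  have "real j = real (j div k) * real k + real (j mod k)"
    by (metis div_mult_mod_eq of_nat_add of_nat_mult)
  moreover have "real (j mod k) + 1 \<le> real k"
    using mod_less_divisor[OF assms, of j] by linarith
  ultimately show "real (j div k) \<le> real j / real k" "(real j + 1) / real k \<le> real (j div k) + 1"
    using assms by (simp_all add: field_simps)
qed

section \<open>Limits of the parameters and of the partial products\<close>

locale resnet_family = spd_bounds S m M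
  for S :: "'d::finite mat" and m M :: real +
  fixes B :: "'d mat" and th :: "nat \<Rightarrow> nat \<Rightarrow> real \<Rightarrow> 'd mat" and a b :: real and N0 :: nat
  assumes N0: "1 \<le> N0" and a: "0 \<le> a" and b: "0 \<le> b"
    and flows: "1 \<le> N \<Longrightarrow> gradient_flow S m M B N (th N)"
    and init_smooth: "Suc i < N \<Longrightarrow> norm (th N (Suc (Suc i)) 0 - th N (Suc i) 0) \<le> a / real N"
    and init_refine: "N0 \<le> N \<Longrightarrow> j < N * k \<Longrightarrow>
      norm (th (N * k) (Suc j) 0 - th N (Suc (j div k)) 0) \<le> b / real N"
begin

definition "smooth_const = a + 16 * kappa / rate"
definition "refine_const = (b + 1) * barrier_bound"

lemma smooth_const_nonneg: "0 \<le> smooth_const"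
  using a kappa_pos rate_pos by (simp add: smooth_const_def)

lemma refine_const_nonneg: "0 \<le> refine_const"
  using b by (simp add: refine_const_def barrier_bound_def)

lemma layers_at: "1 \<le> N \<Longrightarrow> 0 \<le> t \<Longrightarrow> layered S m M N (\<lambda>n. th N n t)"
  using gradient_flow.small_always[OF flows] by blast

lemma param_index_Lipschitz:
  assumes t: "0 \<le> t" and "i < N" "i' < N"
  shows "norm (th N (Suc i) t - th N (Suc i') t) \<le> smooth_const * \<bar>real i - real i'\<bar> / real N"
proof -
  interpret gradient_flow S m M B N "th N" using assms by (intro flows) auto
  have "norm (th N (Suc i) t - th N (Suc i') t) \<le> smooth_const / real N * \<bar>real i - real i'\<bar>"
    using assms unfolding smooth_const_def
    by (intro norm_diff_le_steps[where f = "\<lambda>i. th N (Suc i) t" and N = N] param_smooth init_smooth) auto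
  then show ?thesis by simp
qed

lemma param_refine:
  assumes "0 \<le> t" "N0 \<le> N" "j < N * k"
  shows "norm (th (N * k) (Suc j) t - th N (Suc (j div k)) t) \<le> refine_const / real N"
proof -
  have "1 \<le> N" "1 \<le> N * k" using assms N0 by (cases k; simp)+
  then interpret flow_pair S m M B N k "th N" "th (N * k)" b
    using assms b init_refine
    by (intro flow_pair.intro flows flow_pair_axioms.intro) auto
  show ?thesis unfolding refine_const_def using gap_le[OF assms(1,3)] .
qed

abbreviation "psi_approx N s t \<equiv> psiN N (th N) s t"

lemma psi_refine:
  assumes "0 \<le> t" "N0 \<le> N" "1 \<le> k" "0 \<le> s" "s \<le> 1"
  shows "norm (psi_approx (N * k) s t - psi_approx N s t) \<le> (refine_const + 5 * smooth_const) / real N"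
proof -
  let ?j = "floor_idx (N * k) s - 1" and ?i = "floor_idx N s - 1"
  have N: "1 \<le> N" "1 \<le> N * k" using assms N0 by auto
  have j: "?j < N * k" by (rule psi_idx_less) (use N assms in auto)
  have i: "?i < N" by (rule psi_idx_less) (use N assms in auto)
  have n: "?j div k < N" using j by (simp add: less_mult_imp_div_less)
  have k: "1 \<le> real k" using assms by simp
  have "\<bar>real ?j - real N * s * real k\<bar> \<le> 2 * real k"
    using psi_idx_close[of s "N * k"] assms k by (simp add: mult_ac)
  then have 1: "\<bar>real ?j / real k - real N * s\<bar> \<le> 2"
    using k by (simp add: abs_le_iff field_simps)
  have "real ?j / real k \<le> (real ?j + 1) / real k" by (simp add: divide_right_mono)
  then have 2: "real (?j div k) \<le> real ?j / real k" "real ?j / real k \<le> real (?j div k) + 1"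
    using nat_div_real_bounds[of k ?j] k by linarith+
  \<comment> \<open>The 5 is 2 + 2 for the two shifted floors and 1 for the integer division:
    subtraction of 1 does not commute with \<open>div k\<close>.\<close>
  have "\<bar>real (?j div k) - real ?i\<bar> \<le> 5"
    using 1 2 psi_idx_close[of s N] assms by linarith
  then have "smooth_const * \<bar>real (?j div k) - real ?i\<bar> / real N \<le> smooth_const * 5 / real N"
    using smooth_const_nonneg by (intro divide_right_mono mult_left_mono) auto
  then have "norm (th N (Suc (?j div k)) t - th N (Suc ?i) t) \<le> smooth_const * 5 / real N"
    by (rule order.trans[OF param_index_Lipschitz[OF assms(1) n i]])
  then show ?thesis
    using param_refine[OF assms(1,2) j]
      norm_triangle_ineq[of "th (N * k) (Suc ?j) t - th N (Suc (?j div k)) t" "th N (Suc (?j div k)) t - th N (Suc ?i) t"]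
    by (simp add: psiN_eq add_divide_distrib mult.commute)
qed

abbreviation "prefix N s t \<equiv> seg (layer N (\<lambda>n. th N n t)) 0 (floor_idx N s)"

lemma prefix_refine:
  assumes "0 \<le> t" "N0 \<le> N" "1 \<le> k" "0 \<le> s" "s \<le> 1"
  shows "norm (prefix (N * k) s t - prefix N s t) \<le> 6 * (refine_const + 1) * norm (mat 1 :: 'd mat) / real N"
proof -
  have N: "1 \<le> N" "1 \<le> N * k" using assms N0 by auto
  interpret refined_layers N k "\<lambda>n. th N n t" "\<lambda>n. th (N * k) n t" "refine_const / real N"
    using layers_at[OF N(1) assms(1)] layers_at[OF N(2) assms(1)]
      order.trans[OF spec_norm_le_norm param_refine] assms
    by (intro refined_layers.intro refined_layers_axioms.intro) (auto simp: layered_def)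
  have "spec_norm (prefix (N * k) s t - prefix N s t) \<le> 6 * (refine_const / real N + 1 / real N)"
    using spec_norm_prefix_refine[of "floor_idx (N * k) s"] floor_idx_le assms k_pos
    by (simp add: floor_idx_div)
  then have "norm (prefix (N * k) s t - prefix N s t) \<le> 6 * (refine_const / real N + 1 / real N) * norm (mat 1 :: 'd mat)"
    by (intro order.trans[OF norm_le_spec_norm] mult_right_mono) auto
  then show ?thesis by (simp add: add_divide_distrib distrib_right)
qed

text \<open>A discrete form of the ODE. The increment \<open>x\<close> allows for rounding of the
  two endpoints to layers. Freezing the right-hand side at either endpoint lets the limit yield
  difference quotients from both sides.\<close>

lemma prefix_first_order:
  assumes t: "0 \<le> t" and N: "1 \<le> N" and s: "0 \<le> s" "s \<le> s'" "s' \<le> 1" and r: "r = s \<or> r = s'"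
  defines "x \<equiv> (s' - s) + 1 / real N"
  shows "norm (prefix N s' t - prefix N s t - (s' - s) *\<^sub>R (psi_approx N r t ** prefix N r t))
    \<le> (2 * (x\<^sup>2 + x * (smooth_const * (x + 1 / real N)) + 1 / (2 * real N)) + (s' - s) * x) * norm (mat 1 :: 'd mat)"
proof -
  interpret layered S m M N "\<lambda>n. th N n t" by (rule layers_at) fact+
  let ?i = "floor_idx N s" and ?i' = "floor_idx N s'" and ?p = "psi_approx N r t"
  define y where "y = real (?i' - ?i) / real N"
  have ii: "?i \<le> ?i'" "?i' \<le> N" using s by (simp_all add: floor_idx_mono floor_idx_le)
  have "real (?i' - ?i) \<le> real N * (s' - s) + 1" "real N * (s' - s) \<le> real (?i' - ?i) + 1"
    using floor_idx_bounds[of s N] floor_idx_bounds[of s' N] s ii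
    by (auto simp: of_nat_diff algebra_simps)
  then have y: "y \<le> x" "\<bar>y - (s' - s)\<bar> \<le> 1 / real N" "0 \<le> y"
    using N_pos by (auto simp: y_def x_def field_simps abs_le_iff)
  have x0: "0 \<le> x" using s by (simp add: x_def)
  have ridx: "floor_idx N r - 1 < N" by (rule psi_idx_less) (use N s r in auto)
  have p: "spec_norm ?p \<le> 1/2"
    using small[OF ridx] by (simp add: psiN_eq)
  let ?S = "\<Sum>l=?i..<?i'. th N (Suc l) t"
  have R1: "spec_norm (seg F ?i ?i' - mat 1 - (1 / real N) *\<^sub>R ?S) \<le> x\<^sup>2"
    using spec_norm_seg_first_order[OF ii] power_mono[OF y(1,3), of 2] by (simp add: y_def)
  have R2: "spec_norm ((1 / real N) *\<^sub>R ?S - y *\<^sub>R ?p) \<le> x * (smooth_const * (x + 1 / real N))"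
  proof -
    have "(\<Sum>l=?i..<?i'. th N (Suc l) t - ?p) = ?S - real (?i' - ?i) *\<^sub>R ?p"
      by (simp add: sum_subtractf sum_constant_scaleR del: sum_constant)
    then have "(1 / real N) *\<^sub>R ?S - y *\<^sub>R ?p = (1 / real N) *\<^sub>R (\<Sum>l=?i..<?i'. th N (Suc l) t - ?p)"
      by (simp add: y_def scaleR_diff_right)
    also have "spec_norm \<dots> \<le> (1 / real N) * (\<Sum>l=?i..<?i'. smooth_const * (x + 1 / real N))"
    proof -
      have "spec_norm (\<Sum>l=?i..<?i'. th N (Suc l) t - ?p) \<le> (\<Sum>l=?i..<?i'. smooth_const * (x + 1 / real N))"
      proof (rule order.trans[OF spec_norm_sum_le sum_mono])
        fix l assume l: "l \<in> {?i..<?i'}"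
        have "\<bar>real l - real (floor_idx N r - 1)\<bar> \<le> real (?i' - ?i) + 1"
          using l r by (auto simp: of_nat_diff abs_le_iff)
        then have "smooth_const * \<bar>real l - real (floor_idx N r - 1)\<bar> / real N \<le> smooth_const * (real (?i' - ?i) + 1) / real N"
          using smooth_const_nonneg by (intro divide_right_mono mult_left_mono) auto
        also have "\<dots> = smooth_const * (y + 1 / real N)"
          by (simp add: y_def add_divide_distrib distrib_left)
        also have "\<dots> \<le> smooth_const * (x + 1 / real N)"
          using y smooth_const_nonneg by (intro mult_left_mono) auto
        finally show "spec_norm (th N (Suc l) t - ?p) \<le> smooth_const * (x + 1 / real N)"
          using param_index_Lipschitz[OF t _ ridx, of l] l ii spec_norm_le_norm[of "th N (Suc l) t - ?p"]
          by (simp add: psiN_eq)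
      qed
      then show ?thesis by (simp add: spec_norm_scaleR divide_right_mono)
    qed
    also have "\<dots> = y * (smooth_const * (x + 1 / real N))" by (simp add: y_def)
    also have "\<dots> \<le> x * (smooth_const * (x + 1 / real N))"
      using y x0 smooth_const_nonneg by (intro mult_right_mono) auto
    finally show ?thesis .
  qed
  have R3: "spec_norm (y *\<^sub>R ?p - (s' - s) *\<^sub>R ?p) \<le> 1 / (2 * real N)"
    using mult_mono[OF y(2) p] by (simp add: scaleR_diff_left[symmetric] spec_norm_scaleR del: scaleR_diff_left)
  let ?U = "seg F ?i ?i' - mat 1 - (s' - s) *\<^sub>R ?p"
  have "?U = (seg F ?i ?i' - mat 1 - (1 / real N) *\<^sub>R ?S) + ((1 / real N) *\<^sub>R ?S - y *\<^sub>R ?p) + (y *\<^sub>R ?p - (s' - s) *\<^sub>R ?p)"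
    by simp
  also have "spec_norm \<dots> \<le> x\<^sup>2 + x * (smooth_const * (x + 1 / real N)) + 1 / (2 * real N)"
    by (intro order.trans[OF spec_norm_add_le] add_mono R1 R2 R3)
  finally have "spec_norm (?U ** prefix N s t) \<le> (x\<^sup>2 + x * (smooth_const * (x + 1 / real N)) + 1 / (2 * real N)) * 2"
    using ii x0 smooth_const_nonneg
    by (intro order.trans[OF spec_norm_mult_le] mult_mono spec_norm_seg) auto
  then have U: "spec_norm (?U ** prefix N s t) \<le> 2 * (x\<^sup>2 + x * (smooth_const * (x + 1 / real N)) + 1 / (2 * real N))"
    by (simp only: mult.commute)
  have "spec_norm (prefix N s t - prefix N r t) \<le> 2 * x"
  proof (cases "r = s")
    case True
    then show ?thesis using x0 by simp
  next
    case False
    with r have "r = s'" by simp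
    then show ?thesis
      using order.trans[OF spec_norm_seg_shift_right[of 0 ?i ?i', folded y_def] mult_left_mono[OF y(1)]] ii
      by (simp add: spec_norm_minus_commute)
  qed
  moreover have "spec_norm ((s' - s) *\<^sub>R ?p) \<le> (s' - s) * (1/2)"
    using mult_left_mono[OF p, of "s' - s"] s by (simp add: spec_norm_scaleR)
  ultimately have "spec_norm ((s' - s) *\<^sub>R ?p ** (prefix N s t - prefix N r t)) \<le> ((s' - s) * (1/2)) * (2 * x)"
    using s by (intro order.trans[OF spec_norm_mult_le] mult_mono) auto
  then have V: "spec_norm ((s' - s) *\<^sub>R ?p ** (prefix N s t - prefix N r t)) \<le> (s' - s) * x" by simp
  have "prefix N s' t = seg F ?i ?i' ** prefix N s t" using ii by (simp add: seg_compose)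
  then have eq: "prefix N s' t - prefix N s t - (s' - s) *\<^sub>R (?p ** prefix N r t)
      = ?U ** prefix N s t + (s' - s) *\<^sub>R ?p ** (prefix N s t - prefix N r t)"
    by (simp add: mm.diff_left mm.diff_right mm.scaleR_left)
  show ?thesis unfolding eq
    by (intro order.trans[OF norm_le_spec_norm] mult_right_mono order.trans[OF spec_norm_add_le]
        add_mono U V) simp
qed

definition "psi_rate = refine_const + 5 * smooth_const"
definition "prefix_rate = 6 * (refine_const + 1) * norm (mat 1 :: 'd mat)"

definition "psi_lim s t = lim (\<lambda>N. psi_approx N s t)"
definition "prefix_lim s t = lim (\<lambda>N. prefix N s t)"

lemma psi_lim:
  assumes "0 \<le> t" "0 \<le> s" "s \<le> 1"
  shows "(\<lambda>N. psi_approx N s t) \<longlonglongrightarrow> psi_lim s t"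
    and "N0 \<le> N \<Longrightarrow> norm (psi_approx N s t - psi_lim s t) \<le> psi_rate / real N"
proof -
  obtain l where l: "(\<lambda>N. psi_approx N s t) \<longlonglongrightarrow> l"
    "\<And>N. N0 \<le> N \<Longrightarrow> dist (psi_approx N s t) l \<le> psi_rate / real N"
    by (rule limit_of_multiplicative_Cauchy[where u = "\<lambda>N. psi_approx N s t" and K = psi_rate, OF N0])
      (use psi_refine assms smooth_const_nonneg refine_const_nonneg in \<open>auto simp: dist_norm psi_rate_def\<close>)
  have "psi_lim s t = l" unfolding psi_lim_def by (rule limI) (rule l)
  with l show "(\<lambda>N. psi_approx N s t) \<longlonglongrightarrow> psi_lim s t"
    "N0 \<le> N \<Longrightarrow> norm (psi_approx N s t - psi_lim s t) \<le> psi_rate / real N"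
    by (auto simp: dist_norm)
qed

lemma prefix_lim:
  assumes "0 \<le> t" "0 \<le> s" "s \<le> 1"
  shows "(\<lambda>N. prefix N s t) \<longlonglongrightarrow> prefix_lim s t"
    and "N0 \<le> N \<Longrightarrow> norm (prefix N s t - prefix_lim s t) \<le> prefix_rate / real N"
proof -
  obtain l where l: "(\<lambda>N. prefix N s t) \<longlonglongrightarrow> l"
    "\<And>N. N0 \<le> N \<Longrightarrow> dist (prefix N s t) l \<le> prefix_rate / real N"
    by (rule limit_of_multiplicative_Cauchy[where u = "\<lambda>N. prefix N s t" and K = prefix_rate, OF N0])
      (use prefix_refine assms refine_const_nonneg in \<open>auto simp: dist_norm prefix_rate_def\<close>)
  have "prefix_lim s t = l" unfolding prefix_lim_def by (rule limI) (rule l)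
  with l show "(\<lambda>N. prefix N s t) \<longlonglongrightarrow> prefix_lim s t"
    "N0 \<le> N \<Longrightarrow> norm (prefix N s t - prefix_lim s t) \<le> prefix_rate / real N"
    by (auto simp: dist_norm)
qed

lemma one_over_n: "(\<lambda>N. 1 / real N) \<longlonglongrightarrow> 0"
  by (rule lim_const_over_n)

text \<open>At finite depth the bound in \<open>s\<close> holds up to a jump of order 1/N caused by
  index rounding; the jump vanishes in the limit.\<close>

lemma psi_lim_Lipschitz:
  assumes "0 \<le> t" "0 \<le> t'" "0 \<le> s" "s \<le> 1" "0 \<le> s'" "s' \<le> 1"
  shows "norm (psi_lim s t - psi_lim s' t') \<le> smooth_const * \<bar>s - s'\<bar> + 4 * kappa * \<bar>t - t'\<bar>"
proof (rule tendsto_le[OF sequentially_bot])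
  show "(\<lambda>N. norm (psi_approx N s t - psi_approx N s' t')) \<longlonglongrightarrow> norm (psi_lim s t - psi_lim s' t')"
    by (intro tendsto_intros psi_lim assms)
  show "(\<lambda>N. smooth_const * (\<bar>s - s'\<bar> + 4 * (1 / real N)) + 4 * kappa * \<bar>t - t'\<bar>)
      \<longlonglongrightarrow> smooth_const * \<bar>s - s'\<bar> + 4 * kappa * \<bar>t - t'\<bar>"
    by (rule tendsto_eq_intros one_over_n refl)+ simp
  show "\<forall>\<^sub>F N in sequentially. norm (psi_approx N s t - psi_approx N s' t')
      \<le> smooth_const * (\<bar>s - s'\<bar> + 4 * (1 / real N)) + 4 * kappa * \<bar>t - t'\<bar>"
    using eventually_ge_at_top[of 1]
  proof eventually_elim
    fix N :: nat assume N: "1 \<le> N"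
    interpret gradient_flow S m M B N "th N" by (rule flows) fact
    let ?i = "floor_idx N s - 1" and ?i' = "floor_idx N s' - 1"
    have i: "?i < N" "?i' < N" by (rule psi_idx_less; use N assms in simp)+
    have "\<bar>real N * s - real N * s'\<bar> = real N * \<bar>s - s'\<bar>"
      by (simp add: right_diff_distrib[symmetric] abs_mult del: right_diff_distrib)
    moreover have "\<bar>x - y\<bar> \<le> \<bar>v - w\<bar> + 4" if "\<bar>x - v\<bar> \<le> 2" "\<bar>y - w\<bar> \<le> 2" for x y v w :: real
      using that by linarith
    ultimately have "\<bar>real ?i - real ?i'\<bar> \<le> real N * \<bar>s - s'\<bar> + 4"
      using psi_idx_close assms by metis
    then have "smooth_const * \<bar>real ?i - real ?i'\<bar> / real N \<le> smooth_const * (real N * \<bar>s - s'\<bar> + 4) / real N"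
      using smooth_const_nonneg by (intro divide_right_mono mult_left_mono) auto
    also have "\<dots> = smooth_const * (\<bar>s - s'\<bar> + 4 * (1 / real N))"
      using N by (simp add: field_simps)
    finally have "norm (th N (Suc ?i) t - th N (Suc ?i') t) \<le> smooth_const * (\<bar>s - s'\<bar> + 4 * (1 / real N))"
      using param_index_Lipschitz[OF assms(1) i] by linarith
    moreover have "norm (th N (Suc ?i') t - th N (Suc ?i') t') \<le> 4 * kappa * \<bar>t - t'\<bar>"
      using assms i by (intro param_Lipschitz_time)
    ultimately show "norm (psi_approx N s t - psi_approx N s' t')
        \<le> smooth_const * (\<bar>s - s'\<bar> + 4 * (1 / real N)) + 4 * kappa * \<bar>t - t'\<bar>"
      using norm_triangle_ineq[of "th N (Suc ?i) t - th N (Suc ?i') t" "th N (Suc ?i') t - th N (Suc ?i') t'"]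
      by (simp add: psiN_eq)
  qed
qed

lemma psi_lim_bounded:
  assumes "0 \<le> t" "0 \<le> s" "s \<le> 1"
  shows "norm (psi_lim s t) \<le> norm (mat 1 :: 'd mat) / 2"
proof (rule tendsto_upperbound[OF tendsto_norm[OF psi_lim(1)[OF assms]] _ sequentially_bot])
  show "\<forall>\<^sub>F N in sequentially. norm (psi_approx N s t) \<le> norm (mat 1 :: 'd mat) / 2"
    using eventually_ge_at_top[of 1]
  proof eventually_elim
    fix N :: nat assume N: "1 \<le> N"
    interpret layered S m M N "\<lambda>n. th N n t" by (rule layers_at) fact+
    show "norm (psi_approx N s t) \<le> norm (mat 1 :: 'd mat) / 2"
      using mult_right_mono[OF small[OF psi_idx_less[OF N assms(3)]], of "norm (mat 1 :: 'd mat)"]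
        norm_le_spec_norm[of "psi_approx N s t"]
      by (simp add: psiN_eq)
  qed
qed

lemma prefix_lim_first_order:
  assumes t: "0 \<le> t" and s: "0 \<le> s" "s \<le> s'" "s' \<le> 1" and r: "r = s \<or> r = s'"
  shows "norm (prefix_lim s' t - prefix_lim s t - (s' - s) *\<^sub>R (psi_lim r t ** prefix_lim r t))
    \<le> (3 + 2 * smooth_const) * norm (mat 1 :: 'd mat) * (s' - s)\<^sup>2"
proof (rule tendsto_le[OF sequentially_bot])
  let ?h = "s' - s"
  let ?x = "\<lambda>N. ?h + 1 / real N"
  have r': "0 \<le> r" "r \<le> 1" using r s by auto
  show "(\<lambda>N. norm (prefix N s' t - prefix N s t - ?h *\<^sub>R (psi_approx N r t ** prefix N r t)))
      \<longlonglongrightarrow> norm (prefix_lim s' t - prefix_lim s t - ?h *\<^sub>R (psi_lim r t ** prefix_lim r t))"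
    using s r' by (intro tendsto_intros mm.tendsto psi_lim prefix_lim t) auto
  have "(\<lambda>N. (2 * ((?x N)\<^sup>2 + ?x N * (smooth_const * (?x N + 1 / real N)) + 1 / 2 * (1 / real N)) + ?h * ?x N) * norm (mat 1 :: 'd mat))
      \<longlonglongrightarrow> (2 * ((?h + 0)\<^sup>2 + (?h + 0) * (smooth_const * (?h + 0 + 0)) + 1 / 2 * 0) + ?h * (?h + 0)) * norm (mat 1 :: 'd mat)"
    by (intro tendsto_intros one_over_n)
  then show "(\<lambda>N. (2 * ((?x N)\<^sup>2 + ?x N * (smooth_const * (?x N + 1 / real N)) + 1 / (2 * real N)) + ?h * ?x N) * norm (mat 1 :: 'd mat))
      \<longlonglongrightarrow> (3 + 2 * smooth_const) * norm (mat 1 :: 'd mat) * ?h\<^sup>2"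
    by (simp add: algebra_simps power2_eq_square)
  show "\<forall>\<^sub>F N in sequentially. norm (prefix N s' t - prefix N s t - ?h *\<^sub>R (psi_approx N r t ** prefix N r t))
      \<le> (2 * ((?x N)\<^sup>2 + ?x N * (smooth_const * (?x N + 1 / real N)) + 1 / (2 * real N)) + ?h * ?x N) * norm (mat 1 :: 'd mat)"
    using eventually_ge_at_top[of 1] by eventually_elim (intro prefix_first_order t s r)
qed

lemma prefix_lim_derivative:
  assumes t: "0 \<le> t" and s: "s \<in> {0..1}"
  shows "((\<lambda>s. prefix_lim s t) has_vector_derivative psi_lim s t ** prefix_lim s t) (at s within {0..1})"
proof (rule has_vector_derivative_quadratic_remainder)
  fix y :: real assume y: "y \<in> {0..1}"
  show "norm (prefix_lim y t - prefix_lim s t - (y - s) *\<^sub>R (psi_lim s t ** prefix_lim s t))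
      \<le> (3 + 2 * smooth_const) * norm (mat 1 :: 'd mat) * (y - s)\<^sup>2"
  proof (cases "s \<le> y")
    case True
    then show ?thesis using prefix_lim_first_order[of t s y s] t s y by simp
  next
    \<comment> \<open>To the left of \<open>s\<close> the base point is the right endpoint, which is
      the choice \<open>r = s'\<close> of the first-order estimate.\<close>
    case False
    have "prefix_lim y t - prefix_lim s t - (y - s) *\<^sub>R (psi_lim s t ** prefix_lim s t)
        = - (prefix_lim s t - prefix_lim y t - (s - y) *\<^sub>R (psi_lim s t ** prefix_lim s t))"
      by (simp add: algebra_simps)
    then have "norm (prefix_lim y t - prefix_lim s t - (y - s) *\<^sub>R (psi_lim s t ** prefix_lim s t))
        = norm (prefix_lim s t - prefix_lim y t - (s - y) *\<^sub>R (psi_lim s t ** prefix_lim s t))"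
      by (simp only: norm_minus_cancel)
    then show ?thesis
      using prefix_lim_first_order[of t y s s] t s y False by (simp add: power2_commute)
  qed
qed

lemma prefix_lim_0: "0 \<le> t \<Longrightarrow> prefix_lim 0 t = mat 1"
  by (intro LIMSEQ_unique[OF prefix_lim(1)[of t 0]]) (auto simp: floor_idx_def)

lemma neural_ode_solution:
  assumes t: "0 \<le> t" and s: "s \<in> {0..1}"
  shows "((\<lambda>s. prefix_lim s t *v x0) has_vector_derivative psi_lim s t *v (prefix_lim s t *v x0)) (at s within {0..1})"
proof -
  have "linear (\<lambda>A :: 'd mat. A *v x0)"
    by (rule linearI) (simp_all add: matrix_vector_mult_add_rdistrib scaleR_matrix_vector_assoc)
  then have "bounded_linear (\<lambda>A :: 'd mat. A *v x0)" by (simp add: linear_conv_bounded_linear)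
  from bounded_linear.has_vector_derivative[OF this prefix_lim_derivative[OF assms]]
  show ?thesis by (simp add: matrix_vector_mul_assoc)
qed

lemma neural_ode_unique:
  assumes t: "0 \<le> t"
    and x: "\<And>s. s \<in> {0..1} \<Longrightarrow> (x has_vector_derivative psi_lim s t *v x s) (at s within {0..1})"
  shows "x 1 = prefix_lim 1 t *v x 0"
proof -
  let ?z = "\<lambda>s. x s - prefix_lim s t *v x 0"
  have "?z 1 = 0"
  proof (rule linear_ode_zero[where A = "\<lambda>s. psi_lim s t" and L = "norm (mat 1 :: 'd mat) / 2"])
    fix s :: real assume s: "s \<in> {0..1}"
    show "(?z has_vector_derivative psi_lim s t *v ?z s) (at s within {0..1})"
      using has_vector_derivative_diff[OF x[OF s] neural_ode_solution[OF t s]]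
      by (simp add: matrix_vector_mult_diff_distrib)
    show "norm (psi_lim s t) \<le> norm (mat 1 :: 'd mat) / 2" using psi_lim_bounded t s by simp
  qed (simp add: prefix_lim_0 t)
  then show ?thesis by simp
qed

text \<open>At \<open>s = 1\<close> the prefix is the whole network, so its limit is both the limit
  of \<open>PiN\<close> and the end value of the ODE flow.\<close>

lemma PiN_eq_prefix: "PiN N (\<lambda>n. th N n t) = prefix N 1 t"
  by (simp add: PiN_def resprod_eq_seg floor_idx_def)

end

theorem theorem1:
  fixes Sig B :: "real^'d::finite^'d"
    and M m :: real
    and th :: "nat \<Rightarrow> nat \<Rightarrow> real \<Rightarrow> real^'d^'d"
  assumes Sig_spd: "sym_pos_def Sig"
    and M_def: "M = Max (eigvals Sig)"
    and m_def: "m = Min (eigvals Sig)"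
    and flow: "\<And>N. N \<ge> 1 \<Longrightarrow> grad_flow Sig B N (th N)"
    and init_loss: "\<And>N. N \<ge> 1 \<Longrightarrow>
       sqrt (lossN Sig B N (\<lambda>k. th N k 0)) < m / (4 * sqrt (2 * M * exp 3))"
    and init_small: "\<And>N n. N \<ge> 1 \<Longrightarrow> n \<in> {1..N} \<Longrightarrow> spec_norm (th N n 0) \<le> 1/4"
    and init_smooth: "\<exists>C0>0. \<forall>N\<ge>1. \<forall>n\<in>{1..<N}.
       spec_norm (th N (n+1) 0 - th N n 0) \<le> C0 / real N"
    and init_lim: "\<exists>psi_init :: real \<Rightarrow> real^'d^'d. \<exists>C. \<exists>N0.
       \<forall>N\<ge>N0. \<forall>s\<in>{0..1}. spec_norm (psiN N (th N) s 0 - psi_init s) \<le> C / real N"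
  shows "\<exists>psi :: real \<Rightarrow> real \<Rightarrow> real^'d^'d.
     (\<forall>e>0. \<exists>N0. \<forall>N\<ge>N0. \<forall>s\<in>{0..1}. \<forall>t\<ge>0.
        spec_norm (psiN N (th N) s t - psi s t) < e)
   \<and> (\<exists>L. \<forall>s\<in>{0..1}. \<forall>s'\<in>{0..1}. \<forall>t\<ge>0. \<forall>t'\<ge>0.
        spec_norm (psi s t - psi s' t') \<le> L * (\<bar>s - s'\<bar> + \<bar>t - t'\<bar>))
   \<and> (\<exists>C N0. \<forall>N\<ge>N0. \<forall>s\<in>{0..1}. \<forall>t\<ge>0.
        spec_norm (psi s t - psiN N (th N) s t) \<le> C / real N)
   \<and> (\<exists>Phi :: real \<Rightarrow> real^'d^'d.
        (\<forall>t\<ge>0. \<forall>x0.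
           (\<exists>x :: real \<Rightarrow> real^'d. x 0 = x0 \<and>
              (\<forall>s\<in>{0..1}. (x has_vector_derivative (psi s t *v x s)) (at s within {0..1})))
         \<and> (\<forall>x :: real \<Rightarrow> real^'d. x 0 = x0 \<and>
              (\<forall>s\<in>{0..1}. (x has_vector_derivative (psi s t *v x s)) (at s within {0..1}))
              \<longrightarrow> x 1 = Phi t *v x0))
      \<and> (\<forall>e>0. \<exists>N0. \<forall>N\<ge>N0. \<forall>t\<ge>0.
           spec_norm (PiN N (\<lambda>k. th N k t) - Phi t) < e))"
proof -
  note ray = rayleigh_bounds[OF Sig_spd, folded M_def m_def]
  interpret spd_bounds Sig m M
    using ray Sig_spd by unfold_locales (auto simp: sym_pos_def_def)
  let ?I = "norm (mat 1 :: real^'d^'d)"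
  obtain C0 where C0: "0 < C0" "\<And>N n. 1 \<le> N \<Longrightarrow> n \<in> {1..<N} \<Longrightarrow>
      spec_norm (th N (n+1) 0 - th N n 0) \<le> C0 / real N"
    using init_smooth by blast
  obtain psi_init C N1 where lim: "\<And>N s. N1 \<le> N \<Longrightarrow> s \<in> {0..1} \<Longrightarrow>
      spec_norm (psiN N (th N) s 0 - psi_init s) \<le> C / real N"
    using init_lim by blast
  define a where "a = ?I * C0"
  \<comment> \<open>Two comparisons with \<open>psi_init\<close> give the first term; the second
    accounts for an index mismatch of at most 3. The factors \<open>?I\<close> convert to the
    Frobenius norm.\<close>
  define b where "b = 2 * ?I * \<bar>C\<bar> + 3 * a"
  define N0 where "N0 = max 1 N1"
  have a: "0 \<le> a" using C0 by (simp add: a_def)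
  have smooth0: "norm (th N (Suc (Suc i)) 0 - th N (Suc i) 0) \<le> a / real N" if "Suc i < N" for N i
  proof -
    have "norm (th N (Suc (Suc i)) 0 - th N (Suc i) 0) \<le> C0 / real N * ?I"
      using C0(2)[of N "Suc i"] that by (intro order.trans[OF norm_le_spec_norm] mult_right_mono) auto
    then show ?thesis by (simp add: a_def mult.commute)
  qed
  interpret resnet_family Sig m M B th a b N0
  proof (intro resnet_family.intro spd_bounds_axioms resnet_family_axioms.intro)
    show "1 \<le> N0" by (simp add: N0_def)
    show "0 \<le> a" by fact
    show "0 \<le> b" using a by (simp add: b_def)
    show "gradient_flow Sig m M B N (th N)" if "1 \<le> N" for N
      using that by unfold_locales (use flow init_loss init_small in auto)
    show "norm (th N (Suc (Suc i)) 0 - th N (Suc i) 0) \<le> a / real N" if "Suc i < N" for N i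
      by (rule smooth0) fact
    show "norm (th (N * k) (Suc j) 0 - th N (Suc (j div k)) 0) \<le> b / real N"
      if N: "N0 \<le> N" and j: "j < N * k" for N k j
    proof -
      have k: "0 < k" using j by (cases k) auto
      have N': "1 \<le> N" "N1 \<le> N" using N by (simp_all add: N0_def)
      have Nk: "N \<le> N * k" using k by simp
      \<comment> \<open>At this position the fine \<open>psiN\<close> selects exactly parameter
        \<open>Suc j\<close>, while the coarse one selects a parameter close to
        \<open>Suc (j div k)\<close>.\<close>
      define s where "s = real (Suc j) / real (N * k)"
      have "real (Suc j) \<le> real (N * k)" using j by (simp only: of_nat_le_iff Suc_le_eq)
      from divide_right_mono[OF this, of "real (N * k)"]
      have s: "s \<in> {0..1}" using k N' by (simp add: s_def)
      have Nks: "real (N * k) * s = real (Suc j)" using N' k by (simp add: s_def)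
      have Ns: "real N * s = (real j + 1) / real k" using N' by (simp add: s_def add.commute)
      let ?i = "floor_idx N s - 1"
      have fine: "psiN (N * k) (th (N * k)) s 0 = th (N * k) (Suc j) 0"
        unfolding psiN_eq floor_idx_def Nks by (simp only: floor_of_nat nat_int diff_Suc_1)
      have near: "norm (psiN n (th n) s 0 - psi_init s) \<le> ?I * \<bar>C\<bar> / real N" if "N \<le> n" for n
      proof -
        have "C / real n \<le> \<bar>C\<bar> / real N"
          using that N' by (intro frac_le) auto
        then have "norm (psiN n (th n) s 0 - psi_init s) \<le> \<bar>C\<bar> / real N * ?I"
          using lim[of n s] that N' s by (intro order.trans[OF norm_le_spec_norm] mult_right_mono) auto
        then show ?thesis by (simp add: mult.commute)
      qed
      have "norm (th (N * k) (Suc j) 0 - th N (Suc ?i) 0)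
          \<le> norm (psiN (N * k) (th (N * k)) s 0 - psi_init s) + norm (psiN N (th N) s 0 - psi_init s)"
        using norm_triangle_ineq4[of "psiN (N * k) (th (N * k)) s 0 - psi_init s" "psiN N (th N) s 0 - psi_init s"]
        by (simp add: fine psiN_eq[of N])
      also have "\<dots> \<le> ?I * \<bar>C\<bar> / real N + ?I * \<bar>C\<bar> / real N"
        by (intro add_mono near Nk order.refl)
      finally have 1: "norm (th (N * k) (Suc j) 0 - th N (Suc ?i) 0) \<le> 2 * ?I * \<bar>C\<bar> / real N"
        by (simp only: mult_2 distrib_right add_divide_distrib)
      have "real (j div k) \<le> (real j + 1) / real k"
        using nat_div_real_bounds(1)[OF k, of j] by (rule order.trans) (simp add: divide_right_mono)
      moreover have "\<bar>real ?i - (real j + 1) / real k\<bar> \<le> 2"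
        using psi_idx_close[of s N] s by (simp add: Ns)
      ultimately have "\<bar>real ?i - real (j div k)\<bar> \<le> 3"
        using nat_div_real_bounds(2)[OF k, of j] by linarith
      then have "a / real N * \<bar>real ?i - real (j div k)\<bar> \<le> a / real N * 3"
        using a by (intro mult_left_mono) auto
      also have "a / real N * 3 = 3 * a / real N" by simp
      finally have "a / real N * \<bar>real ?i - real (j div k)\<bar> \<le> 3 * a / real N" .
      moreover have "norm (th N (Suc ?i) 0 - th N (Suc (j div k)) 0) \<le> a / real N * \<bar>real ?i - real (j div k)\<bar>"
        using smooth0 psi_idx_less[of N s] N' s j
        by (intro norm_diff_le_steps[where f = "\<lambda>i. th N (Suc i) 0" and N = N])
          (auto simp: less_mult_imp_div_less)
      ultimately have "norm (th N (Suc ?i) 0 - th N (Suc (j div k)) 0) \<le> 3 * a / real N" by linarith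
      then show ?thesis
        using 1 norm_triangle_ineq[of "th (N * k) (Suc j) 0 - th N (Suc ?i) 0" "th N (Suc ?i) 0 - th N (Suc (j div k)) 0"]
        by (simp add: b_def add_divide_distrib)
    qed
  qed
  have psi_close: "spec_norm (psiN N (th N) s t - psi_lim s t) \<le> psi_rate / real N"
    if "N0 \<le> N" "s \<in> {0..1}" "0 \<le> t" for N s t
    using psi_lim(2)[of t s N] that order.trans[OF spec_norm_le_norm] by simp
  have Pi_close: "spec_norm (PiN N (\<lambda>n. th N n t) - prefix_lim 1 t) \<le> prefix_rate / real N"
    if "N0 \<le> N" "0 \<le> t" for N t
    using prefix_lim(2)[of t 1 N] that order.trans[OF spec_norm_le_norm] by (simp add: PiN_eq_prefix)
  have small: "\<exists>N'\<ge>N0. \<forall>N\<ge>N'. K / real N < e" if "0 < e" for K e :: real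
  proof -
    have "\<forall>\<^sub>F N in sequentially. N0 \<le> N \<and> K / real N < e"
      using order_tendstoD(2)[OF lim_const_over_n that, of K] eventually_ge_at_top[of N0]
      by eventually_elim simp
    then show ?thesis unfolding eventually_sequentially by (metis order.refl)
  qed
  show ?thesis
  proof (intro exI[of _ psi_lim] conjI)
    show "\<forall>e>0. \<exists>N0. \<forall>N\<ge>N0. \<forall>s\<in>{0..1}. \<forall>t\<ge>0. spec_norm (psiN N (th N) s t - psi_lim s t) < e"
      by (meson small psi_close order.trans order_le_less_trans)
    show "\<exists>L. \<forall>s\<in>{0..1}. \<forall>s'\<in>{0..1}. \<forall>t\<ge>0. \<forall>t'\<ge>0.
        spec_norm (psi_lim s t - psi_lim s' t') \<le> L * (\<bar>s - s'\<bar> + \<bar>t - t'\<bar>)"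
    proof (intro exI[of _ "smooth_const + 4 * kappa"] ballI allI impI)
      fix s s' t t' :: real assume "s \<in> {0..1}" "s' \<in> {0..1}" "0 \<le> t" "0 \<le> t'"
      then have "spec_norm (psi_lim s t - psi_lim s' t') \<le> smooth_const * \<bar>s - s'\<bar> + 4 * kappa * \<bar>t - t'\<bar>"
        using order.trans[OF spec_norm_le_norm psi_lim_Lipschitz] by simp
      also have "\<dots> \<le> (smooth_const + 4 * kappa) * (\<bar>s - s'\<bar> + \<bar>t - t'\<bar>)"
        using smooth_const_nonneg kappa_pos by (simp add: distrib_left distrib_right)
      finally show "spec_norm (psi_lim s t - psi_lim s' t') \<le> (smooth_const + 4 * kappa) * (\<bar>s - s'\<bar> + \<bar>t - t'\<bar>)" .
    qed
    show "\<exists>C N0. \<forall>N\<ge>N0. \<forall>s\<in>{0..1}. \<forall>t\<ge>0. spec_norm (psi_lim s t - psiN N (th N) s t) \<le> C / real N"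
      using psi_close spec_norm_minus_commute by metis
    show "\<exists>Phi :: real \<Rightarrow> real^'d^'d.
        (\<forall>t\<ge>0. \<forall>x0.
           (\<exists>x :: real \<Rightarrow> real^'d. x 0 = x0 \<and>
              (\<forall>s\<in>{0..1}. (x has_vector_derivative (psi_lim s t *v x s)) (at s within {0..1})))
         \<and> (\<forall>x :: real \<Rightarrow> real^'d. x 0 = x0 \<and>
              (\<forall>s\<in>{0..1}. (x has_vector_derivative (psi_lim s t *v x s)) (at s within {0..1}))
              \<longrightarrow> x 1 = Phi t *v x0))
      \<and> (\<forall>e>0. \<exists>N0. \<forall>N\<ge>N0. \<forall>t\<ge>0.
           spec_norm (PiN N (\<lambda>k. th N k t) - Phi t) < e)"
    proof (intro exI[of _ "\<lambda>t. prefix_lim 1 t"] conjI allI impI)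
      fix t :: real and x0 :: "real^'d" assume t: "0 \<le> t"
      show "\<exists>x. x 0 = x0 \<and> (\<forall>s\<in>{0..1}. (x has_vector_derivative (psi_lim s t *v x s)) (at s within {0..1}))"
        by (rule exI[of _ "\<lambda>s. prefix_lim s t *v x0"]) (simp add: prefix_lim_0 t neural_ode_solution)
      show "x 1 = prefix_lim 1 t *v x0"
        if "x 0 = x0 \<and> (\<forall>s\<in>{0..1}. (x has_vector_derivative (psi_lim s t *v x s)) (at s within {0..1}))" for x
        using neural_ode_unique[OF t, of x] that by simp
    next
      fix e :: real assume "0 < e"
      from small[OF this, of prefix_rate] obtain N'
        where "N0 \<le> N'" "\<And>N. N' \<le> N \<Longrightarrow> prefix_rate / real N < e" by blast
      then show "\<exists>N0. \<forall>N\<ge>N0. \<forall>t\<ge>0. spec_norm (PiN N (\<lambda>k. th N k t) - prefix_lim 1 t) < e"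
        by (intro exI[of _ N'] allI impI order_le_less_trans[OF Pi_close]) auto
    qed
  qed
qed

end
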